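(* Every nonzero (finite-dimensional) formally real Jordan algebra containing no one-dimensional simple ideal admits a Jordan-Einstein metric of negative Jordan scalar curvature.
   Context: A (real) Jordan algebra is a real vector space $\mathscr{A}$ with a bilinear product satisfying $XY=YX$ and $X(X^2Y)=X^2(XY)$. It is simple if $\mathscr{A}^2\ne0$ and it has no nontrivial ideals. It is formally real if it has an identity element and $X^2+Y^2=0$ implies $X=Y=0$. Given an arbitrary (positive definite) inner product $\langle\cdot,\cdot\rangle$ on $\mathscr{A}$, the Jordan-Levi-Civita connection is the unique bilinear map $(X,Y)\mapsto\nabla_XY$ with $\nabla_XY+\nabla_YX=XY$ and $\langle\nabla_XY,Z\rangle=\langle Y,\nabla_XZ\rangle$ for all $X,Y,Z$; explicitly $\langle\nabla_XY,Z\rangle=\frac12(\langle XY,Z\rangle-\langle YZ,X\rangle+\langle ZX,Y\rangle)$. The Jordan curvature tensor is $R(X,Y)Z=-\nabla_X\nabla_YZ-\nabla_Y\nabla_XZ+\nabla_{XY}Z$. Put $\operatorname{ric}(U,V)=\operatorname{Tr}(X\mapsto R(U,X)V)$ and $\operatorname{Ric}(U,V)=\frac12(\operatorname{ric}(U,V)+\operatorname{ric}(V,U))$. The inner product is a Jordan-Einstein metric on $\mathscr{A}$ if $\operatorname{Ric}=c\langle\cdot,\cdot\rangle$ for some constant $c\in\mathbb{R}$. The Jordan scalar curvature is $\mathrm{sc}=\operatorname{Tr}_{\langle\cdot,\cdot\rangle}\operatorname{Ric}=\sum_i\operatorname{Ric}(E_i,E_i)$ for an orthonormal basis $\{E_i\}$.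 *)

theory Defs
  imports "HOL-Analysis.Analysis"
begin

section \<open>Algebras\<close>

text \<open>An algebra is a real vector space, given by a type, with a bilinear product \<open>mul\<close> on it;
  ideals are subspaces of that type.\<close>

definition jordan_product :: "('a::real_vector \<Rightarrow> 'a \<Rightarrow> 'a) \<Rightarrow> bool" where
  "jordan_product mul \<longleftrightarrow> bilinear mul \<and>
     (\<forall>x y. mul x y = mul y x) \<and>
     (\<forall>x y. mul x (mul (mul x x) y) = mul (mul x x) (mul x y))"

definition formally_real :: "('a::real_vector \<Rightarrow> 'a \<Rightarrow> 'a) \<Rightarrow> bool" where
  "formally_real mul \<longleftrightarrow>
     (\<exists>e. \<forall>x. mul e x = x \<and> mul x e = x) \<and>
     (\<forall>x y. mul x x + mul y y = 0 \<longrightarrow> x = 0 \<and> y = 0)"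

definition ideal_in :: "('a::real_vector \<Rightarrow> 'a \<Rightarrow> 'a) \<Rightarrow> 'a set \<Rightarrow> 'a set \<Rightarrow> bool" where
  "ideal_in mul S J \<longleftrightarrow> subspace J \<and> J \<subseteq> S \<and> (\<forall>x\<in>S. \<forall>y\<in>J. mul x y \<in> J \<and> mul y x \<in> J)"

text \<open>Simplicity of a subalgebra \<open>S\<close> refers to the ideals of \<open>S\<close> itself, not to those ideals of
  the ambient algebra that lie in \<open>S\<close>.\<close>

definition simple_algebra_on :: "('a::real_vector \<Rightarrow> 'a \<Rightarrow> 'a) \<Rightarrow> 'a set \<Rightarrow> bool" where
  "simple_algebra_on mul S \<longleftrightarrow>
     (\<exists>x\<in>S. \<exists>y\<in>S. mul x y \<noteq> 0) \<and> (\<forall>J. ideal_in mul S J \<longrightarrow> J = {0} \<or> J = S)"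

definition simple_ideal :: "('a::real_vector \<Rightarrow> 'a \<Rightarrow> 'a) \<Rightarrow> 'a set \<Rightarrow> bool" where
  "simple_ideal mul S \<longleftrightarrow> ideal_in mul UNIV S \<and> simple_algebra_on mul S"

section \<open>Traces and inner products\<close>

text \<open>The trace does not depend on the chosen basis, see \<open>lin_trace_eq\<close> below.\<close>

definition lin_trace :: "('a::real_vector \<Rightarrow> 'a) \<Rightarrow> real" where
  "lin_trace f = (let B = (SOME B. independent B \<and> span B = UNIV)
                  in \<Sum>b\<in>B. representation B (f b) b)"

definition inner_product :: "('a::real_vector \<Rightarrow> 'a \<Rightarrow> real) \<Rightarrow> bool" where
  "inner_product ip \<longleftrightarrow> bilinear ip \<and> (\<forall>x y. ip x y = ip y x) \<and> (\<forall>x. x \<noteq> 0 \<longrightarrow> ip x x > 0)"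

definition orthonormal_basis :: "('a::real_vector \<Rightarrow> 'a \<Rightarrow> real) \<Rightarrow> 'a set \<Rightarrow> bool" where
  "orthonormal_basis ip E \<longleftrightarrow>
     finite E \<and> span E = UNIV \<and> (\<forall>e\<in>E. \<forall>f\<in>E. ip e f = (if e = f then 1 else 0))"

text \<open>The trace of a bilinear form with respect to an inner product; see \<open>form_trace_eq\<close>.\<close>

definition form_trace ::
    "('a::real_vector \<Rightarrow> 'a \<Rightarrow> real) \<Rightarrow> ('a \<Rightarrow> 'a \<Rightarrow> real) \<Rightarrow> real" where
  "form_trace ip \<beta> = (\<Sum>e\<in>(SOME E. orthonormal_basis ip E). \<beta> e e)"

section \<open>The Jordan-Levi-Civita connection and its curvature\<close>

definition is_jordan_levi_civita ::
    "('a::real_vector \<Rightarrow> 'a \<Rightarrow> 'a) \<Rightarrow> ('a \<Rightarrow> 'a \<Rightarrow> real) \<Rightarrow> ('a \<Rightarrow> 'a \<Rightarrow> 'a) \<Rightarrow> bool" where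
  "is_jordan_levi_civita mul ip N \<longleftrightarrow> bilinear N \<and>
     (\<forall>x y. N x y + N y x = mul x y) \<and> (\<forall>x y z. ip (N x y) z = ip y (N x z))"

text \<open>Existence and uniqueness are \<open>ex1_jordan_levi_civita\<close> below.\<close>

definition jordan_nabla ::
    "('a::real_vector \<Rightarrow> 'a \<Rightarrow> 'a) \<Rightarrow> ('a \<Rightarrow> 'a \<Rightarrow> real) \<Rightarrow> 'a \<Rightarrow> 'a \<Rightarrow> 'a" where
  "jordan_nabla mul ip = (THE N. is_jordan_levi_civita mul ip N)"

definition jordan_curvature ::
    "('a::real_vector \<Rightarrow> 'a \<Rightarrow> 'a) \<Rightarrow> ('a \<Rightarrow> 'a \<Rightarrow> real) \<Rightarrow> 'a \<Rightarrow> 'a \<Rightarrow> 'a \<Rightarrow> 'a" where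
  "jordan_curvature mul ip x y z =
     (let N = jordan_nabla mul ip in - N x (N y z) - N y (N x z) + N (mul x y) z)"

definition jordan_ric ::
    "('a::real_vector \<Rightarrow> 'a \<Rightarrow> 'a) \<Rightarrow> ('a \<Rightarrow> 'a \<Rightarrow> real) \<Rightarrow> 'a \<Rightarrow> 'a \<Rightarrow> real" where
  "jordan_ric mul ip u v = lin_trace (\<lambda>x. jordan_curvature mul ip u x v)"

definition jordan_Ric ::
    "('a::real_vector \<Rightarrow> 'a \<Rightarrow> 'a) \<Rightarrow> ('a \<Rightarrow> 'a \<Rightarrow> real) \<Rightarrow> 'a \<Rightarrow> 'a \<Rightarrow> real" where
  "jordan_Ric mul ip u v = (jordan_ric mul ip u v + jordan_ric mul ip v u) / 2"

definition jordan_einstein_metric ::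
    "('a::real_vector \<Rightarrow> 'a \<Rightarrow> 'a) \<Rightarrow> ('a \<Rightarrow> 'a \<Rightarrow> real) \<Rightarrow> bool" where
  "jordan_einstein_metric mul ip \<longleftrightarrow>
     inner_product ip \<and> (\<exists>c. \<forall>u v. jordan_Ric mul ip u v = c * ip u v)"

definition jordan_scalar_curvature ::
    "('a::real_vector \<Rightarrow> 'a \<Rightarrow> 'a) \<Rightarrow> ('a \<Rightarrow> 'a \<Rightarrow> real) \<Rightarrow> real" where
  "jordan_scalar_curvature mul ip = form_trace ip (jordan_Ric mul ip)"

section \<open>Well-definedness\<close>

lemma lin_trace_basis_indep:
  fixes f :: "'a::real_vector \<Rightarrow> 'a"
  assumes f: "linear f"
    and B: "independent B" "span B = UNIV" "finite B"
    and C: "independent C" "span C = UNIV" "finite C"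
  shows "(\<Sum>b\<in>B. representation B (f b) b) = (\<Sum>c\<in>C. representation C (f c) c)"
proof -
  have repB: "(\<Sum>b\<in>B. representation B v b *\<^sub>R b) = v" for v
    by (rule real_vector.sum_representation_eq) (use B in auto)
  have repC: "(\<Sum>c\<in>C. representation C v c *\<^sub>R c) = v" for v
    by (rule real_vector.sum_representation_eq) (use C in auto)
  have comb: "representation D (\<Sum>i\<in>I. g i *\<^sub>R h i) d = (\<Sum>i\<in>I. g i * representation D (h i) d)"
    if "independent D" "span D = UNIV" for D :: "'a set" and I :: "'a set" and g h d
    using that by (simp add: real_vector.representation_sum real_vector.representation_scale)
  have "(\<Sum>b\<in>B. representation B (f b) b)
      = (\<Sum>b\<in>B. \<Sum>c\<in>C. representation C (f b) c * representation B c b)"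
    by (subst (1) repC[symmetric]) (simp only: comb[OF B(1,2)])
  also have "\<dots> = (\<Sum>c\<in>C. \<Sum>b\<in>B. representation B c b * representation C (f b) c)"
    by (subst sum.swap) (simp add: mult.commute)
  also have "\<dots> = (\<Sum>c\<in>C. representation C (\<Sum>b\<in>B. representation B c b *\<^sub>R f b) c)"
    by (simp only: comb[OF C(1,2)])
  also have "\<dots> = (\<Sum>c\<in>C. representation C (f (\<Sum>b\<in>B. representation B c b *\<^sub>R b)) c)"
    by (simp add: linear_sum[OF f] linear_scale[OF f])
  finally show ?thesis by (simp only: repB)
qed

lemma lin_trace_eq:
  fixes f :: "'a::real_vector \<Rightarrow> 'a"
  assumes "linear f" "independent B" "span B = UNIV" "finite B"
  shows "lin_trace f = (\<Sum>b\<in>B. representation B (f b) b)"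
proof -
  define C where "C = (SOME C::'a set. independent C \<and> span C = UNIV)"
  have C: "independent C \<and> span C = UNIV"
    unfolding C_def by (rule someI[of _ B]) (use assms in auto)
  have "finite C"
    using real_vector.independent_span_bound[OF assms(4), of C] C assms(3) by auto
  then show ?thesis
    unfolding lin_trace_def C_def[symmetric] Let_def
    using lin_trace_basis_indep[OF assms(1) _ _ _ assms(2-4), of C] C by auto
qed

lemma inner_productD:
  assumes "inner_product ip"
  shows "bilinear ip" "ip x y = ip y x" "x \<noteq> 0 \<Longrightarrow> ip x x > 0"
  using assms by (auto simp: inner_product_def)

lemma inner_product_eqI:
  assumes "inner_product ip" "\<And>z. ip x z = ip y z"
  shows "x = y"
proof -
  have "ip (x - y) (x - y) = 0"
    using assms(2)[of "x - y"] bilinear_lsub[OF inner_productD(1)[OF assms(1)], of x y "x - y"] by simp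
  then show ?thesis using inner_productD(3)[OF assms(1), of "x - y"] by force
qed

lemma bilinear_sum_left:
  assumes "bilinear h" shows "h (\<Sum>i\<in>I. g i *\<^sub>R f i) y = (\<Sum>i\<in>I. g i *\<^sub>R h (f i) y)"
proof -
  have "linear (\<lambda>x. h x y)" using assms by (simp add: bilinear_def)
  from linear_sum[OF this, of "\<lambda>i. g i *\<^sub>R f i" I] linear_scale[OF this] show ?thesis by simp
qed

lemma bilinear_sum_right:
  assumes "bilinear h" shows "h y (\<Sum>i\<in>I. g i *\<^sub>R f i) = (\<Sum>i\<in>I. g i *\<^sub>R h y (f i))"
proof -
  have "linear (h y)" using assms by (simp add: bilinear_def)
  from linear_sum[OF this, of "\<lambda>i. g i *\<^sub>R f i" I] linear_scale[OF this] show ?thesis by simp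
qed

lemma exists_orthonormal_basis:
  assumes ip: "inner_product (ip :: 'a::real_vector \<Rightarrow> 'a \<Rightarrow> real)"
    and "\<exists>B::'a set. finite B \<and> span B = UNIV"
  shows "\<exists>E. orthonormal_basis ip E"
proof -
  note bil = inner_productD(1)[OF ip]
  have "\<exists>E. finite E \<and> span E = span B \<and> (\<forall>e\<in>E. \<forall>f\<in>E. ip e f = (if e = f then 1 else 0))"
    if "finite B" for B :: "'a set"
    using that
  proof (induction B)
    case empty
    show ?case by (rule exI[of _ "{}"]) auto
  next
    case (insert b B)
    then obtain E where E: "finite E" "span E = span B"
      "\<And>e f. e \<in> E \<Longrightarrow> f \<in> E \<Longrightarrow> ip e f = (if e = f then 1 else 0)" by blast
    define p where "p = (\<Sum>e\<in>E. ip b e *\<^sub>R e)"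
    define u where "u = b - p"
    have p: "p \<in> span E" unfolding p_def by (intro span_sum span_scale span_base)
    have sp: "span (insert b B) = span (insert b E)"
      using E(2) by (simp add: span_insert)
    have ue: "ip u e = 0" if "e \<in> E" for e
    proof -
      have "ip p e = (\<Sum>f\<in>E. ip b f * ip f e)"
        unfolding p_def by (simp add: bilinear_sum_left[OF bil])
      also have "\<dots> = (\<Sum>f\<in>E. if f = e then ip b f else 0)"
        by (rule sum.cong) (use E(3) that in auto)
      also have "\<dots> = ip b e" using E(1) that by simp
      finally show ?thesis by (simp add: u_def bilinear_lsub[OF bil])
    qed
    show ?case
    proof (cases "u = 0")
      case True
      then have "b \<in> span E" using p by (simp add: u_def)
      then have "span E = span (insert b B)" by (simp add: sp span_redundant)
      then show ?thesis using E by blast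
    next
      case False
      define r where "r = sqrt (ip u u)"
      define w where "w = (1 / r) *\<^sub>R u"
      have r: "r > 0" "r * r = ip u u"
        using inner_productD(3)[OF ip False] by (auto simp: r_def)
      have ww: "ip w w = 1"
        using r(1) by (simp add: w_def bilinear_lmul[OF bil] bilinear_rmul[OF bil] r(2)[symmetric])
      have we: "ip w e = 0" "ip e w = 0" if "e \<in> E" for e
        using ue[OF that] inner_productD(2)[OF ip, of e w] by (simp_all add: w_def bilinear_lmul[OF bil])
      have "b = p + r *\<^sub>R w" using r by (simp add: w_def u_def)
      then have "b \<in> span (insert w E)"
        using p by (simp add: span_add span_scale span_base span_mono[THEN subsetD, of E "insert w E"] subset_insertI)
      moreover have "w \<in> span (insert b E)"
        unfolding w_def u_def using p
        by (intro span_scale span_diff) (auto intro: span_base span_mono[THEN subsetD, of E "insert b E"])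
      ultimately have "span (insert w E) = span (insert b E)"
        by (intro span_eq[THEN iffD2]) (auto intro: span_base)
      moreover have "ip e f = (if e = f then 1 else 0)"
        if "e \<in> insert w E" "f \<in> insert w E" for e f
        using that ww we E(3) by fastforce
      ultimately show ?thesis using E(1) sp by (intro exI[of _ "insert w E"]) auto
    qed
  qed
  then show ?thesis using assms(2) unfolding orthonormal_basis_def by metis
qed

lemma orthonormal_basis_expand:
  assumes ip: "inner_product ip" and E: "orthonormal_basis ip E"
  shows "(\<Sum>e\<in>E. ip v e *\<^sub>R e) = v"
proof -
  note bil = inner_productD(1)[OF ip]
  let ?w = "\<Sum>e\<in>E. ip v e *\<^sub>R e"
  have fin: "finite E" using E by (simp add: orthonormal_basis_def)
  have *: "ip ?w e = ip v e" if "e \<in> E" for e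
  proof -
    have "ip ?w e = (\<Sum>f\<in>E. if f = e then ip v f else 0)"
      unfolding bilinear_sum_left[OF bil]
      by (rule sum.cong) (use E that in \<open>auto simp: orthonormal_basis_def\<close>)
    then show ?thesis using fin that by simp
  qed
  have "ip ?w z = ip v z" for z
  proof (rule linear_eq_on_span[of "ip ?w" "ip v" E z])
    show "linear (ip ?w)" "linear (ip v)" using bil by (auto simp: bilinear_def)
    show "z \<in> span E" using E by (simp add: orthonormal_basis_def)
  qed (use * in auto)
  then show ?thesis by (rule inner_product_eqI[OF ip])
qed

lemma form_trace_basis_indep:
  fixes \<beta> :: "'a::real_vector \<Rightarrow> 'a \<Rightarrow> real"
  assumes ip: "inner_product ip" and \<beta>: "bilinear \<beta>"
    and E: "orthonormal_basis ip E" and F: "orthonormal_basis ip F"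
  shows "(\<Sum>e\<in>E. \<beta> e e) = (\<Sum>f\<in>F. \<beta> f f)"
proof -
  note bil = inner_productD(1)[OF ip]
  have "(\<Sum>e\<in>E. \<beta> e e) = (\<Sum>e\<in>E. \<Sum>f\<in>F. \<Sum>g\<in>F. ip e f * (ip e g * \<beta> f g))"
  proof (rule sum.cong[OF refl])
    fix e
    have "\<beta> e e = \<beta> (\<Sum>f\<in>F. ip e f *\<^sub>R f) (\<Sum>g\<in>F. ip e g *\<^sub>R g)"
      by (simp only: orthonormal_basis_expand[OF ip F])
    then show "\<beta> e e = (\<Sum>f\<in>F. \<Sum>g\<in>F. ip e f * (ip e g * \<beta> f g))"
      by (subst sum.swap)
        (simp add: bilinear_sum_left[OF \<beta>] bilinear_sum_right[OF \<beta>] sum_distrib_left mult.left_commute)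
  qed
  also have "\<dots> = (\<Sum>f\<in>F. \<Sum>g\<in>F. \<Sum>e\<in>E. ip e f * (ip e g * \<beta> f g))"
    by (subst sum.swap, rule sum.cong[OF refl], rule sum.swap)
  also have "\<dots> = (\<Sum>f\<in>F. \<Sum>g\<in>F. ip f g * \<beta> f g)"
  proof (intro sum.cong refl)
    fix f g
    have "ip f g = ip (\<Sum>e\<in>E. ip f e *\<^sub>R e) g"
      by (simp only: orthonormal_basis_expand[OF ip E])
    also have "\<dots> = (\<Sum>e\<in>E. ip e f * ip e g)"
      by (simp add: bilinear_sum_left[OF bil] inner_productD(2)[OF ip, of f])
    finally show "(\<Sum>e\<in>E. ip e f * (ip e g * \<beta> f g)) = ip f g * \<beta> f g"
      by (simp add: sum_distrib_right mult.assoc)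
  qed
  also have "\<dots> = (\<Sum>f\<in>F. \<Sum>g\<in>F. if g = f then \<beta> f f else 0)"
    by (intro sum.cong refl) (use F in \<open>auto simp: orthonormal_basis_def\<close>)
  also have "\<dots> = (\<Sum>f\<in>F. \<beta> f f)"
    using F by (simp add: orthonormal_basis_def)
  finally show ?thesis .
qed

lemma form_trace_eq:
  assumes "inner_product ip" "bilinear \<beta>" "orthonormal_basis ip E"
  shows "form_trace ip \<beta> = (\<Sum>e\<in>E. \<beta> e e)"
  unfolding form_trace_def
  by (rule form_trace_basis_indep[OF assms(1,2) _ assms(3)]) (rule someI[of "orthonormal_basis ip", OF assms(3)])

lemma jordan_levi_civita_koszul:
  assumes ip: "inner_product ip" and N: "is_jordan_levi_civita mul ip N"
  shows "ip (N x y) z = (ip (mul x y) z - ip (mul y z) x + ip (mul z x) y) / 2"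
proof -
  note ladd = bilinear_ladd[OF inner_productD(1)[OF ip]]
  have m: "mul a b = N a b + N b a" for a b using N by (simp add: is_jordan_levi_civita_def)
  have s: "ip (N a b) c = ip (N a c) b" for a b c
    using N inner_productD(2)[OF ip, of b "N a c"] by (simp add: is_jordan_levi_civita_def)
  show ?thesis
    by (simp add: m ladd s[of x z y] s[of y z x] s[of z y x])
qed

lemma ex1_jordan_levi_civita:
  fixes ip :: "'a::real_vector \<Rightarrow> 'a \<Rightarrow> real"
  assumes ip: "inner_product ip" and fd: "\<exists>B::'a set. finite B \<and> span B = UNIV"
    and mul: "bilinear mul" "\<And>x y. mul x y = mul y x"
  shows "\<exists>!N. is_jordan_levi_civita mul ip N"
proof (rule ex_ex1I)
  note bil = inner_productD(1)[OF ip]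
  note sym = inner_productD(2)[OF ip]
  note lin = bilinear_ladd[OF bil] bilinear_radd[OF bil] bilinear_lmul[OF bil] bilinear_rmul[OF bil]
    bilinear_ladd[OF mul(1)] bilinear_radd[OF mul(1)] bilinear_lmul[OF mul(1)] bilinear_rmul[OF mul(1)]
  obtain E where E: "orthonormal_basis ip E" using exists_orthonormal_basis[OF ip fd] ..
  define k where "k x y z = (ip (mul x y) z - ip (mul y z) x + ip (mul z x) y) / 2" for x y z
  define N where "N x y = (\<Sum>e\<in>E. k x y e *\<^sub>R e)" for x y
  have kz: "linear (k x y)" for x y
    by (rule linearI) (simp_all add: k_def lin field_simps)
  have ipN: "ip (N x y) z = k x y z" for x y z
  proof -
    have "k x y z = k x y (\<Sum>e\<in>E. ip z e *\<^sub>R e)"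
      by (simp only: orthonormal_basis_expand[OF ip E])
    also have "\<dots> = (\<Sum>e\<in>E. ip z e * k x y e)"
      by (simp add: linear_sum[OF kz] linear_scale[OF kz])
    also have "\<dots> = ip (N x y) z"
      by (simp add: N_def bilinear_sum_left[OF bil] sym[of z] mult.commute)
    finally show ?thesis by simp
  qed
  have "bilinear N"
    unfolding bilinear_def
  proof (intro conjI allI linearI)
    fix x y z and c :: real
    show "N x (y + z) = N x y + N x z" "N (y + z) x = N y x + N z x"
      "N x (c *\<^sub>R y) = c *\<^sub>R N x y" "N (c *\<^sub>R y) x = c *\<^sub>R N y x"
      by (rule inner_product_eqI[OF ip], simp add: ipN k_def lin field_simps)+
  qed
  moreover have "N x y + N y x = mul x y" for x y
  proof (rule inner_product_eqI[OF ip])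
    fix z show "ip (N x y + N y x) z = ip (mul x y) z"
      by (simp add: ipN k_def lin mul(2)[of y x] mul(2)[of z x] mul(2)[of z y] field_simps)
  qed
  moreover have "ip (N x y) z = ip y (N x z)" for x y z
    unfolding sym[of y] ipN k_def
    by (simp add: mul(2)[of z x] mul(2)[of z y] mul(2)[of y x])
  ultimately show "\<exists>N. is_jordan_levi_civita mul ip N"
    unfolding is_jordan_levi_civita_def by blast
next
  fix N N' assume "is_jordan_levi_civita mul ip N" "is_jordan_levi_civita mul ip N'"
  then show "N = N'"
    by (intro ext inner_product_eqI[OF ip]) (simp add: jordan_levi_civita_koszul[OF ip])
qed

end

theory Submission
  imports Defs "HOL-Computational_Algebra.Fundamental_Theorem_Algebra"
begin

text \<open>
  Write \<open>L\<^sub>x\<close> for multiplication by \<open>x\<close>. Formal reality makes the associative form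
  \<open>\<tau> x y = Tr L\<^bsub>xy\<^esub>\<close> positive definite (\<open>\<tau>_inner\<close>), and the algebra is the
  \<open>\<tau>\<close>-orthogonal sum of minimal ideals cut out by central idempotents \<open>p\<close>, the blocks
  (\<open>exists_block\<close>, \<open>sum_blocks\<close>). The metric \<open>\<tau>\<close> itself is not Einstein: its connection is
  half the product, so its Ricci form \<open>(Tr (L\<^sub>u L\<^sub>v) - Tr L\<^bsub>uv\<^esub>) / 4\<close> vanishes on the units
  \<open>p\<close>. The remedy is to shrink the line of \<open>p\<close> inside each block.

  That one parameter per block suffices rests on the following fact (\<open>block_scalar\<close>): on the
  traceless part of a block, that is on the orthogonal complement of \<open>p\<close> in it,
  \<open>\<beta> u v = Tr (L\<^sub>u L\<^sub>v)\<close> equals \<open>\<kappa> \<tau> u v\<close> with a constant \<open>0 < \<kappa> < 1\<close>. The proof rests on the derivations \<open>[L\<^sub>x, L\<^sub>y]\<close>. They are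
  skew for \<open>\<tau>\<close> and preserve \<open>\<beta>\<close>, and \<open>Tr ([L\<^sub>x, L\<^sub>y]\<^sup>2) = - \<beta> x ([L\<^sub>x, L\<^sub>y] y)\<close>; hence
  multiplications by elements of different eigenspaces of \<open>\<beta>\<close> commute. An orthogonal
  splitting of the traceless part into two pieces whose multiplications commute has a zero
  piece, because the two pieces annihilate each other while the square of a nonzero traceless
  element has a nonzero component along \<open>p\<close> (\<open>splitting_trivial\<close>). The bound \<open>\<kappa> < 1\<close> comes
  from summing the same trace identity over an orthonormal basis.

  With the factor \<open>(1 + \<kappa>) / 2\<close> on the line of \<open>p\<close>, relative to the form \<open>\<tau>\<close> divided by
  \<open>\<tau> p p\<close>, each block is Einstein, and its constant is negative as soon as the block is not
  one-dimensional. Rescaling the blocks gives all of them the constant \<open>-1\<close> (\<open>g_einstein\<close>).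
  The computation is short because the Ricci form of any metric is
  \<open>Tr (R\<^sub>u R\<^sub>v) - Tr R\<^bsub>uv\<^esub> / 2\<close>, where \<open>R\<^sub>v\<close> maps \<open>x\<close> to the derivative of \<open>v\<close> along \<open>x\<close>
  (\<open>jordan_Ric_trace\<close>), and here \<open>R\<^sub>v\<close> is a multiplication plus operators of rank one.
\<close>

section \<open>Linear algebra over an inner product\<close>

locale finite_inner_space =
  fixes ip :: "'a::real_vector \<Rightarrow> 'a \<Rightarrow> real" and E :: "'a set"
  assumes inner: "inner_product ip" and onb: "orthonormal_basis ip E"
begin

lemmas ip_bilinear = inner_productD(1)[OF inner]
lemmas ip_sym = inner_productD(2)[OF inner]
lemmas ip_pos = inner_productD(3)[OF inner]
lemmas ip_simps = bilinear_ladd[OF ip_bilinear] bilinear_radd[OF ip_bilinear]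
  bilinear_lsub[OF ip_bilinear] bilinear_rsub[OF ip_bilinear]
  bilinear_lmul[OF ip_bilinear] bilinear_rmul[OF ip_bilinear]
  bilinear_lzero[OF ip_bilinear] bilinear_rzero[OF ip_bilinear]

lemma finite_E: "finite E" and span_E: "span E = UNIV"
  using onb by (auto simp: orthonormal_basis_def)

lemma ip_E: "e \<in> E \<Longrightarrow> f \<in> E \<Longrightarrow> ip e f = (if e = f then 1 else 0)"
  using onb by (auto simp: orthonormal_basis_def)

lemma ip_self_nonneg: "ip x x \<ge> 0"
  using ip_pos[of x] by (cases "x = 0") (auto simp: ip_simps)

lemma ip_self_eq_0: "ip x x = 0 \<longleftrightarrow> x = 0"
  using ip_pos[of x] by (cases "x = 0") (auto simp: ip_simps)

lemma ip_linear: "linear (ip x)" "linear (\<lambda>y. ip y x)"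
  using ip_bilinear by (auto simp: bilinear_def)

lemma expand: "(\<Sum>e\<in>E. ip v e *\<^sub>R e) = v"
  by (rule orthonormal_basis_expand[OF inner onb])

lemma independent_E: "independent E"
proof (rule independent_if_scalars_zero[OF finite_E])
  fix f x assume *: "(\<Sum>x\<in>E. f x *\<^sub>R x) = 0" and x: "x \<in> E"
  have "ip (\<Sum>x\<in>E. f x *\<^sub>R x) x = (\<Sum>y\<in>E. if y = x then f y else 0)"
    unfolding bilinear_sum_left[OF ip_bilinear] by (rule sum.cong) (use x ip_E in auto)
  then show "f x = 0" using x by (simp add: * ip_simps finite_E)
qed

lemma representation_E:
  assumes "e \<in> E" shows "representation E v e = ip v e"
proof -
  have "ip (\<Sum>b\<in>E. representation E v b *\<^sub>R b) e = (\<Sum>y\<in>E. if y = e then representation E v y else 0)"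
    unfolding bilinear_sum_left[OF ip_bilinear] by (rule sum.cong) (use assms ip_E in auto)
  also have "\<dots> = representation E v e" using assms finite_E by simp
  also have "(\<Sum>b\<in>E. representation E v b *\<^sub>R b) = v"
    by (rule real_vector.sum_representation_eq) (use independent_E span_E finite_E in auto)
  finally show ?thesis by simp
qed

lemma trace_eq: "linear f \<Longrightarrow> lin_trace f = (\<Sum>e\<in>E. ip (f e) e)"
  using lin_trace_eq[of f E] independent_E span_E finite_E by (simp add: representation_E)

lemma trace_compose_commute:
  fixes f g :: "'a \<Rightarrow> 'a"
  assumes "linear f" "linear g"
  shows "lin_trace (\<lambda>x. f (g x)) = lin_trace (\<lambda>x. g (f x))"
proof -
  have *: "(\<Sum>e\<in>E. ip (f (g e)) e) = (\<Sum>e\<in>E. \<Sum>d\<in>E. ip (g e) d * ip (f d) e)"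
    if "linear f" for f g :: "'a \<Rightarrow> 'a"
  proof (rule sum.cong[OF refl])
    fix e
    have "ip (f (g e)) e = ip (f (\<Sum>d\<in>E. ip (g e) d *\<^sub>R d)) e" by (simp only: expand)
    also have "\<dots> = (\<Sum>d\<in>E. ip (g e) d * ip (f d) e)"
      by (simp add: linear_sum[OF that] linear_scale[OF that] bilinear_sum_left[OF ip_bilinear])
    finally show "ip (f (g e)) e = (\<Sum>d\<in>E. ip (g e) d * ip (f d) e)" .
  qed
  have "linear (\<lambda>x. f (g x))" "linear (\<lambda>x. g (f x))"
    using linear_compose[OF assms(2,1)] linear_compose[OF assms] by (simp_all add: o_def)
  then have "lin_trace (\<lambda>x. f (g x)) = (\<Sum>e\<in>E. \<Sum>d\<in>E. ip (g e) d * ip (f d) e)"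
      "lin_trace (\<lambda>x. g (f x)) = (\<Sum>e\<in>E. \<Sum>d\<in>E. ip (f e) d * ip (g d) e)"
    by (simp_all add: trace_eq *[OF assms(1)] *[OF assms(2)])
  then show ?thesis by (subst (asm) (2) sum.swap) (simp add: mult.commute)
qed

lemma trace_add:
  fixes f g :: "'a \<Rightarrow> 'a"
  assumes "linear f" "linear g"
  shows "lin_trace (\<lambda>x. f x + g x) = lin_trace f + lin_trace g"
  by (simp add: trace_eq assms linear_compose_add ip_simps sum.distrib)

lemma trace_scaleR:
  fixes f :: "'a \<Rightarrow> 'a"
  assumes "linear f"
  shows "lin_trace (\<lambda>x. c *\<^sub>R f x) = c * lin_trace f"
  by (simp add: trace_eq assms linear_compose_scale_right ip_simps sum_distrib_left)

lemma trace_rank_one: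
  fixes \<phi> :: "'a \<Rightarrow> real"
  assumes "linear \<phi>"
  shows "lin_trace (\<lambda>x. \<phi> x *\<^sub>R b) = \<phi> b"
proof -
  have "linear (\<lambda>x. \<phi> x *\<^sub>R b)"
    by (rule linearI) (simp_all add: linear_add[OF assms] linear_scale[OF assms] scaleR_add_left)
  then have "lin_trace (\<lambda>x. \<phi> x *\<^sub>R b) = (\<Sum>e\<in>E. ip b e * \<phi> e)"
    by (simp add: trace_eq ip_simps mult.commute)
  also have "\<dots> = \<phi> (\<Sum>e\<in>E. ip b e *\<^sub>R e)"
    by (simp add: linear_sum[OF assms] linear_scale[OF assms])
  finally show ?thesis by (simp only: expand)
qed

text \<open>An idempotent is orthogonal for a suitable inner product, and then its trace is the sum of
  the squared lengths of its values on an orthonormal basis.\<close>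

lemma trace_idempotent_nonneg:
  fixes P :: "'a \<Rightarrow> 'a"
  assumes P: "linear P" "\<And>x. P (P x) = P x"
  shows "lin_trace P \<ge> 0" and "P a \<noteq> 0 \<Longrightarrow> lin_trace P > 0"
proof -
  note lin = linear_add[OF P(1)] linear_diff[OF P(1)] linear_scale[OF P(1)] linear_0[OF P(1)]
  define ip' where "ip' x y = ip (P x) (P y) + ip (x - P x) (y - P y)" for x y
  have "bilinear ip'"
    unfolding bilinear_def
    by (intro conjI allI linearI) (simp_all add: ip'_def lin ip_simps algebra_simps)
  moreover have "ip' x y = ip' y x" for x y
    unfolding ip'_def by (simp add: ip_sym)
  moreover have "ip' x x > 0" if "x \<noteq> 0" for x
  proof -
    have "P x \<noteq> 0 \<or> x - P x \<noteq> 0" using that by auto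
    then show ?thesis unfolding ip'_def
      using ip_pos ip_self_nonneg by (metis add_nonneg_pos add_pos_nonneg)
  qed
  ultimately have ip': "inner_product ip'" by (auto simp: inner_product_def)
  obtain F where F: "orthonormal_basis ip' F"
    using exists_orthonormal_basis[OF ip'] finite_E span_E by blast
  interpret F: finite_inner_space ip' F by standard (rule ip' F)+
  have *: "ip' (P x) x = ip' (P x) (P x)" for x
    by (simp add: ip'_def lin P(2) ip_simps)
  have tr: "lin_trace P = (\<Sum>e\<in>F. ip' (P e) (P e))"
    using F.trace_eq[OF P(1)] by (simp add: *)
  show "lin_trace P \<ge> 0" unfolding tr by (intro sum_nonneg F.ip_self_nonneg)
  assume a: "P a \<noteq> 0"
  have "\<exists>e\<in>F. P e \<noteq> 0"
  proof (rule ccontr)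
    assume "\<not> ?thesis"
    then have "P x = 0" for x
      using linear_eq_0_on_span[OF P(1), of F x] F.span_E by auto
    then show False using a by simp
  qed
  then obtain e where e: "e \<in> F" "P e \<noteq> 0" ..
  show "lin_trace P > 0" unfolding tr
    by (rule sum_pos2[OF F.finite_E e(1)]) (use F.ip_pos[OF e(2)] F.ip_self_nonneg in auto)
qed

lemma finite_basis_subspace:
  fixes S :: "'a set"
  assumes "subspace S" obtains B where "finite B" "span B = S"
proof -
  obtain B where B: "B \<subseteq> S" "independent B" "S \<subseteq> span B"
    using real_vector.maximal_independent_subset[of S] by blast
  have "finite B"
    using real_vector.independent_span_bound[OF finite_E, of B] B(2) span_E
    by (auto simp: dependent_raw_def)
  moreover have "span B = S" using B assms by (simp add: span_minimal subset_antisym)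
  ultimately show ?thesis using that by blast
qed

lemma orthogonal_decomposition:
  fixes S :: "'a set"
  assumes "subspace S"
  shows "\<exists>y\<in>S. \<forall>z\<in>S. ip (x - y) z = 0"
proof -
  have "\<forall>x. \<exists>y\<in>span B. \<forall>z\<in>B. ip (x - y) z = 0" if "finite B" for B
    using that
  proof (induction B)
    case (insert b B)
    have sub: "span B \<subseteq> span (insert b B)" by (rule span_mono) auto
    obtain b0 where b0: "b0 \<in> span B" "\<forall>z\<in>B. ip (b - b0) z = 0" using insert.IH by blast
    define c where "c = b - b0"
    have cB: "ip c z = 0" if "z \<in> span B" for z
      by (rule linear_eq_0_on_span[OF ip_linear(1) _ that]) (use b0 in \<open>simp add: c_def\<close>)
    show ?case
    proof
      fix x
      obtain y where y: "y \<in> span B" "\<forall>z\<in>B. ip (x - y) z = 0" using insert.IH by blast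
      have yB: "ip (x - y) z = 0" if "z \<in> span B" for z
        by (rule linear_eq_0_on_span[OF ip_linear(1) _ that]) (use y in simp)
      \<comment> \<open>If \<open>b\<close> already lies in the span, then \<open>c = 0\<close> and the correction vanishes.\<close>
      let ?y = "y + (ip (x - y) c / ip c c) *\<^sub>R c"
      have "b \<in> span (insert b B)" by (simp add: span_base)
      then have "?y \<in> span (insert b B)"
        using y(1) b0(1) sub by (auto simp: c_def intro!: span_add span_scale span_diff)
      moreover have "ip (x - ?y) z = 0" if "z \<in> insert b B" for z
      proof (cases "z = b")
        case False
        then have "z \<in> span B" using that by (simp add: span_base)
        then show ?thesis using yB[of z] cB[of z] by (simp add: ip_simps)
      next
        case True
        have bc: "z = b0 + c" using True by (simp add: c_def)
        show ?thesis unfolding bc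
          using yB[OF b0(1)] cB[OF b0(1)] ip_self_eq_0[of c]
          by (cases "c = 0") (simp_all add: ip_simps)
      qed
      ultimately show "\<exists>y\<in>span (insert b B). \<forall>z\<in>insert b B. ip (x - y) z = 0" by blast
    qed
  qed simp
  moreover obtain B where B: "finite B" "span B = S" using finite_basis_subspace[OF assms] .
  ultimately obtain y where y: "y \<in> S" "\<forall>z\<in>B. ip (x - y) z = 0" by blast
  have "ip (x - y) z = 0" if "z \<in> S" for z
    by (rule linear_eq_0_on_span[OF ip_linear(1), of B]) (use that y B in auto)
  then show ?thesis using y(1) by blast
qed

end

lemma exists_finite_inner_space:
  assumes "\<exists>B::'a::real_vector set. finite B \<and> span B = UNIV"
  shows "\<exists>(ip::'a \<Rightarrow> 'a \<Rightarrow> real) E. finite_inner_space ip E"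
proof -
  obtain S :: "'a set" where S: "finite S" "span S = UNIV" using assms by blast
  obtain B where B: "B \<subseteq> S" "independent B" "S \<subseteq> span B"
    using real_vector.maximal_independent_subset[of S] by blast
  have fin: "finite B" using B S finite_subset by blast
  have sp: "span B = UNIV" using B(3) S(2) span_minimal[OF B(3) subspace_span] by auto
  define ip where "ip x y = (\<Sum>b\<in>B. representation B x b * representation B y b)" for x y
  note rep = real_vector.representation_add[OF B(2)] real_vector.representation_scale[OF B(2)]
  have "bilinear ip"
    unfolding bilinear_def
    by (intro conjI allI linearI)
      (simp_all add: ip_def rep sp algebra_simps sum.distrib sum_distrib_left)
  moreover have "ip x y = ip y x" for x y by (simp add: ip_def mult.commute)
  moreover have "ip x x > 0" if "x \<noteq> 0" for x
  proof -
    have "\<exists>b\<in>B. representation B x b \<noteq> 0"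
    proof (rule ccontr)
      assume "\<not> ?thesis"
      then have "(\<Sum>b\<in>B. representation B x b *\<^sub>R b) = 0" by simp
      moreover have "(\<Sum>b\<in>B. representation B x b *\<^sub>R b) = x"
        by (rule real_vector.sum_representation_eq) (use B fin sp in auto)
      ultimately show False using that by simp
    qed
    then obtain b where b: "b \<in> B" "representation B x b \<noteq> 0" ..
    show ?thesis unfolding ip_def
      by (rule sum_pos2[OF fin b(1)])
        (use b(2) in \<open>auto simp flip: power2_eq_square simp: zero_less_power2\<close>)
  qed
  ultimately have ip: "inner_product ip" by (auto simp: inner_product_def)
  obtain E where "orthonormal_basis ip E" using exists_orthonormal_basis[OF ip assms] ..
  then have "finite_inner_space ip E" using ip by unfold_locales
  then show ?thesis by blast
qed

section \<open>Real polynomials\<close>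

text \<open>The quadratic factors are kept in the form \<open>(X - a)\<^sup>2 + b\<^sup>2\<close>: evaluated at an element of a
  formally real algebra, or at a symmetric operator, it is a sum of two squares, which cannot
  vanish without both summands vanishing.\<close>

lemma real_poly_factor_cases:
  fixes p :: "real poly"
  assumes "degree p > 0"
  shows "(\<exists>a q. p = [:-a, 1:] * q) \<or> (\<exists>a b q. b \<noteq> 0 \<and> p = ([:-a, 1:]^2 + [:b^2:]) * q)"
proof -
  have "degree (map_poly complex_of_real p) = degree p" by (simp add: degree_map_poly)
  then have "\<not> constant (poly (map_poly complex_of_real p))"
    using assms by (simp add: constant_degree)
  then obtain z where z: "poly (map_poly complex_of_real p) z = 0"
    using fundamental_theorem_of_algebra by blast
  define ev where "ev q = poly (map_poly complex_of_real q) z" for q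
  have ev_pCons: "ev (pCons a q) = of_real a + z * ev q" for a q
    by (simp add: ev_def map_poly_pCons)
  have ev_0: "ev 0 = 0" by (simp add: ev_def)
  have ev_add: "ev (q + r) = ev q + ev r" for q r
  proof (induction q arbitrary: r)
    case (pCons a q)
    then show ?case by (cases r) (simp add: ev_pCons algebra_simps)
  qed (simp add: ev_0)
  have ev_smult: "ev (smult c q) = of_real c * ev q" for c q
    by (induction q) (simp_all add: ev_pCons ev_0 algebra_simps)
  have ev_mult: "ev (q * r) = ev q * ev r" for q r
    by (induction q) (simp_all add: ev_pCons ev_0 ev_add ev_smult algebra_simps)
  show ?thesis
  proof (cases "Im z = 0")
    case True
    then have zr: "z = complex_of_real (Re z)" by (simp add: complex_eq_iff)
    have "ev q = of_real (poly q (Re z))" for q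
      by (induction q) (simp_all add: ev_pCons ev_0 flip: zr)
    then have "poly p (Re z) = 0" using z by (simp add: ev_def)
    then have "[:-Re z, 1:] dvd p" by (simp add: poly_eq_0_iff_dvd)
    then show ?thesis unfolding dvd_def by blast
  next
    case False
    define m where "m = [:-Re z, 1:]^2 + [:(Im z)^2:]"
    have dm: "degree m = 2" "m \<noteq> 0" by (auto simp: m_def power2_eq_square)
    define r where "r = p mod m"
    define c d where "c = coeff r 0" and "d = coeff r 1"
    have "degree r < 2 \<or> r = 0" using degree_mod_less[OF dm(2), of p] dm by (auto simp: r_def)
    then have r: "r = [:c, d:]"
      by (intro poly_eqI) (auto simp: c_def d_def coeff_pCons coeff_eq_0 split: nat.split)
    have p: "p = m * (p div m) + r" by (simp add: r_def)
    have "ev m = 0"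
      by (simp add: m_def power2_eq_square ev_add ev_mult ev_pCons ev_0 complex_eq_iff)
    moreover have "ev p = ev m * ev (p div m) + ev r" by (subst p) (simp only: ev_add ev_mult)
    ultimately have "ev r = 0" using z by (simp add: ev_def)
    then have "of_real c + z * of_real d = 0" by (simp add: r ev_pCons ev_0)
    then have "r = 0" using False by (auto simp: r complex_eq_iff)
    then have "p = m * (p div m)" using p by simp
    then show ?thesis using False unfolding m_def by blast
  qed
qed

section \<open>Polynomials in an operator\<close>

text \<open>The vector \<open>p(T) v\<close>. For \<open>T\<close> a multiplication and \<open>v\<close> the unit this is the value of \<open>p\<close> at an
  element of a Jordan algebra, so that one notion serves both operators and elements.\<close>

definition poly_op :: "('a::real_vector \<Rightarrow> 'a) \<Rightarrow> 'a \<Rightarrow> real poly \<Rightarrow> 'a" where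
  "poly_op T v p = fold_coeffs (\<lambda>a u. a *\<^sub>R v + T u) p 0"

lemma poly_op_0 [simp]: "poly_op T v 0 = 0"
  by (simp add: poly_op_def)

lemma poly_op_pCons:
  assumes "linear T"
  shows "poly_op T v (pCons a p) = a *\<^sub>R v + T (poly_op T v p)"
proof (cases "p = 0 \<and> a = 0")
  case True
  then show ?thesis by (simp add: linear_0[OF assms])
next
  case False
  then show ?thesis by (auto simp: poly_op_def)
qed

context
  fixes T :: "'a::real_vector \<Rightarrow> 'a"
  assumes T: "linear T"
begin

lemma poly_op_add: "poly_op T v (p + q) = poly_op T v p + poly_op T v q"
proof (induction p arbitrary: q)
  case (pCons a p)
  then show ?case
    by (cases q) (simp add: poly_op_pCons[OF T] linear_add[OF T] algebra_simps)
qed simp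

lemma poly_op_smult: "poly_op T v (smult c p) = c *\<^sub>R poly_op T v p"
  by (induction p) (simp_all add: poly_op_pCons[OF T] linear_scale[OF T] algebra_simps)

lemma poly_op_diff: "poly_op T v (p - q) = poly_op T v p - poly_op T v q"
  using poly_op_add[of v "p - q" q] by simp

lemma poly_op_sum: "poly_op T v (\<Sum>i\<in>I. f i) = (\<Sum>i\<in>I. poly_op T v (f i))"
  by (induction I rule: infinite_finite_induct) (simp_all add: poly_op_add)

lemma poly_op_mult: "poly_op T v (p * q) = poly_op T (poly_op T v q) p"
  by (induction p) (simp_all add: poly_op_pCons[OF T] poly_op_add poly_op_smult)

lemma poly_op_monom: "poly_op T v (monom c i) = c *\<^sub>R (T ^^ i) v"
  by (induction i)
    (simp_all add: monom_0 monom_Suc poly_op_pCons[OF T] linear_0[OF T] linear_scale[OF T])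

lemma poly_op_in_subspace:
  assumes "subspace S" "\<And>i. (T ^^ i) v \<in> S"
  shows "poly_op T v p \<in> S"
proof -
  have "poly_op T v (\<Sum>i\<le>degree p. monom (coeff p i) i) \<in> S"
    unfolding poly_op_sum poly_op_monom
    by (intro subspace_sum assms subspace_scale)
  then show ?thesis by (simp add: poly_as_sum_of_monoms)
qed

text \<open>The vectors \<open>T\<^sup>i v\<close> cannot be distinct and independent beyond the dimension; a coincidence or
  a linear relation among them is the polynomial.\<close>

lemma exists_annihilating_poly:
  assumes "\<exists>B::'a set. finite B \<and> span B = UNIV"
  shows "\<exists>p. p \<noteq> 0 \<and> poly_op T v p = 0"
proof -
  obtain B :: "'a set" where B: "finite B" "span B = UNIV" using assms by blast
  let ?w = "\<lambda>i. (T ^^ i) v"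
  show ?thesis
  proof (cases "inj_on ?w {..card B}")
    case False
    then obtain i j where ij: "i \<noteq> j" "?w i = ?w j" by (auto simp: inj_on_def)
    have "poly_op T v (monom 1 i - monom 1 j) = 0"
      by (simp add: poly_op_diff poly_op_monom ij)
    moreover have "coeff (monom 1 i - monom (1::real) j) i \<noteq> 0" using ij by simp
    then have "monom 1 i - monom (1::real) j \<noteq> 0" by (metis coeff_0)
    ultimately show ?thesis by blast
  next
    case True
    let ?S = "?w ` {..card B}"
    have "card ?S = Suc (card B)" using True by (simp add: card_image)
    then have "dependent ?S"
      using real_vector.independent_span_bound[OF B(1), of ?S] B(2) by (auto simp: dependent_raw_def)
    then obtain u s where u: "s \<in> ?S" "u s \<noteq> 0" "(\<Sum>s\<in>?S. u s *\<^sub>R s) = 0"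
      by (auto simp: real_vector.dependent_finite)
    then obtain k where k: "k \<le> card B" "s = ?w k" by auto
    let ?p = "\<Sum>i\<le>card B. monom (u (?w i)) i"
    have "coeff ?p k = (\<Sum>i\<le>card B. if i = k then u (?w i) else 0)"
      unfolding coeff_sum by (rule sum.cong) auto
    also have "\<dots> \<noteq> 0" using k u by simp
    finally have "?p \<noteq> 0" by auto
    moreover have "poly_op T v ?p = (\<Sum>s\<in>?S. u s *\<^sub>R s)"
      by (simp add: poly_op_sum poly_op_monom sum.reindex[OF True])
    ultimately show ?thesis using u(3) by metis
  qed
qed

end

text \<open>Factor a polynomial that annihilates a nonzero vector. A linear factor either
  yields an eigenvector or can be cancelled, and a quadratic factor can always be cancelled,
  because \<open>(T - a)\<^sup>2 + b\<^sup>2\<close> is positive definite.\<close>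

lemma (in finite_inner_space) symmetric_has_eigenvector:
  fixes T :: "'a \<Rightarrow> 'a"
  assumes T: "linear T" and sym: "\<And>x y. x \<in> S \<Longrightarrow> y \<in> S \<Longrightarrow> ip (T x) y = ip x (T y)"
    and S: "subspace S" "\<And>x. x \<in> S \<Longrightarrow> T x \<in> S" and v: "v \<in> S" "v \<noteq> 0"
  shows "\<exists>u\<in>S. \<exists>c. u \<noteq> 0 \<and> T u = c *\<^sub>R u"
proof -
  have inS: "poly_op T w p \<in> S" if "w \<in> S" for w p
  proof (rule poly_op_in_subspace[OF T S(1)])
    show "(T ^^ i) w \<in> S" for i by (induction i) (use that S(2) in auto)
  qed
  have "\<exists>u\<in>S. \<exists>c. u \<noteq> 0 \<and> T u = c *\<^sub>R u" if "p \<noteq> 0" "poly_op T v p = 0" for p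
    using that
  proof (induction "degree p" arbitrary: p rule: less_induct)
    case less
    have "degree p > 0"
    proof (rule ccontr)
      assume "\<not> degree p > 0"
      then obtain c where c: "p = [:c:]" by (metis degree_eq_zeroE gr0I)
      then show False using less.prems v by (simp add: poly_op_pCons[OF T] linear_0[OF T])
    qed
    then consider a q where "p = [:-a, 1:] * q"
      | a b q where "b \<noteq> 0" "p = ([:-a, 1:]^2 + [:b^2:]) * q"
      using real_poly_factor_cases by blast
    then show ?case
    proof cases
      case 1
      have q: "q \<noteq> 0" using less.prems 1 by auto
      have d: "degree q < degree p" unfolding 1 by (subst degree_mult_eq) (use q in auto)
      let ?u = "poly_op T v q"
      have "poly_op T ?u [:-a, 1:] = 0" using less.prems(2) unfolding 1 poly_op_mult[OF T] .
      then have "T ?u = a *\<^sub>R ?u" by (simp add: poly_op_pCons[OF T] linear_0[OF T])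
      then show ?thesis using less.hyps[OF d q] inS[OF v(1), of q] by blast
    next
      case 2
      have q: "q \<noteq> 0" using less.prems 2 by auto
      let ?m = "[:-a, 1:]^2 + [:b^2:]"
      have dm: "degree ?m = 2" by (simp add: power2_eq_square)
      then have "?m \<noteq> 0" by (metis degree_0 zero_neq_numeral)
      then have d: "degree q < degree p" unfolding 2(2) degree_mult_eq[OF \<open>?m \<noteq> 0\<close> q] dm by simp
      let ?u = "poly_op T v q"
      define y where "y = T ?u - a *\<^sub>R ?u"
      have u: "?u \<in> S" by (rule inS[OF v(1)])
      have y: "y \<in> S" unfolding y_def by (intro subspace_diff subspace_scale S u)
      have 1: "poly_op T w [:-a, 1:] = T w - a *\<^sub>R w" for w
        by (simp add: poly_op_pCons[OF T] linear_0[OF T])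
      have "poly_op T ?u ?m = T y - a *\<^sub>R y + b^2 *\<^sub>R ?u"
        unfolding poly_op_add[OF T] power2_eq_square[of "[:-a, 1:]"] poly_op_mult[OF T] 1
        by (simp add: y_def poly_op_pCons[OF T] linear_0[OF T])
      then have m: "T y - a *\<^sub>R y + b^2 *\<^sub>R ?u = 0"
        using less.prems(2) unfolding 2(2) poly_op_mult[OF T] by simp
      have "0 = ip (T y - a *\<^sub>R y + b^2 *\<^sub>R ?u) ?u" by (simp add: m ip_simps)
      also have "\<dots> = ip y y + b^2 * ip ?u ?u"
        by (simp add: ip_simps sym[OF y u]) (simp add: y_def ip_simps)
      finally have "b^2 * ip ?u ?u \<le> 0" using ip_self_nonneg[of y] by linarith
      then have "ip ?u ?u \<le> 0" using 2(1) by (simp add: mult_le_0_iff)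
      then have "?u = 0" using ip_pos[of ?u] by force
      then show ?thesis using less.hyps[OF d q] by blast
    qed
  qed
  then show ?thesis
    using exists_annihilating_poly[OF T, of v] finite_E span_E by blast
qed

lemma prod_linear_dvd:
  fixes f :: "real poly"
  assumes "finite R" "\<And>a. a \<in> R \<Longrightarrow> poly f a = 0"
  shows "(\<Prod>a\<in>R. [:-a, 1:]) dvd f"
  using assms
proof (induction R)
  case (insert a R)
  then obtain g where g: "f = (\<Prod>a\<in>R. [:-a, 1:]) * g" by (auto simp: dvd_def)
  have "poly (\<Prod>a\<in>R. [:-a, 1:]) a \<noteq> 0" using insert.hyps by (auto simp: poly_prod)
  then have "poly g a = 0" using insert.prems[of a] by (simp add: g)
  then have "[:-a, 1:] dvd g" by (simp add: poly_eq_0_iff_dvd)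
  then have "[:-a, 1:] * (\<Prod>a\<in>R. [:-a, 1:]) dvd f"
    unfolding g mult.commute[of "\<Prod>a\<in>R. [:-a, 1:]"] by (rule mult_dvd_mono) simp
  then show ?case unfolding prod.insert[OF insert.hyps] .
qed simp

section \<open>Jordan algebras\<close>

locale jordan_algebra =
  fixes mul :: "'a::real_vector \<Rightarrow> 'a \<Rightarrow> 'a" (infixl "\<odot>" 70)
  assumes finite_dim: "\<exists>B::'a set. finite B \<and> span B = UNIV"
    and jordan: "jordan_product mul"
begin

lemma mul_bilinear: "bilinear mul" and mul_comm: "x \<odot> y = y \<odot> x"
  and jordan_identity: "x \<odot> ((x \<odot> x) \<odot> y) = (x \<odot> x) \<odot> (x \<odot> y)"
  using jordan by (auto simp: jordan_product_def)

lemmas mul_simps = bilinear_ladd[OF mul_bilinear] bilinear_radd[OF mul_bilinear]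
  bilinear_lsub[OF mul_bilinear] bilinear_rsub[OF mul_bilinear]
  bilinear_lneg[OF mul_bilinear] bilinear_rneg[OF mul_bilinear]
  bilinear_lmul[OF mul_bilinear] bilinear_rmul[OF mul_bilinear]
  bilinear_lzero[OF mul_bilinear] bilinear_rzero[OF mul_bilinear]

lemma linear_mul: "linear (mul x)" "linear (\<lambda>y. x \<odot> y)" "linear (\<lambda>y. y \<odot> x)"
  using mul_bilinear by (auto simp: bilinear_def)

lemma jordan_polarized:
  "(x \<odot> y) \<odot> (z \<odot> w) + (y \<odot> z) \<odot> (x \<odot> w) + (z \<odot> x) \<odot> (y \<odot> w)
    = z \<odot> ((x \<odot> y) \<odot> w) + x \<odot> ((y \<odot> z) \<odot> w) + y \<odot> ((z \<odot> x) \<odot> w)"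
    (is "?l = ?r")
proof -
  define f where "f x = (x \<odot> x) \<odot> (x \<odot> w) - x \<odot> ((x \<odot> x) \<odot> w)" for x
  have f0: "f x = 0" for x by (simp add: f_def jordan_identity)
  \<comment> \<open>The left-hand side polarizes the cubic map \<open>f\<close>, which vanishes by the Jordan identity.\<close>
  have "f (x + y + z) - f (x + y) - f (y + z) - f (x + z) + f x + f y + f z
      = 2 *\<^sub>R (?l - ?r)"
    by (simp add: f_def mul_simps mul_comm[of y x] mul_comm[of z x] mul_comm[of z y]
        scaleR_2 algebra_simps)
  then show ?thesis by (simp add: f0)
qed

text \<open>The polarized Jordan identity read as a formula for the operator \<open>L\<^bsub>(yz)w\<^esub>\<close>. The
  derivation property of \<open>[L\<^sub>x, L\<^sub>y]\<close>, the associativity of \<open>\<tau>\<close>, power associativity and the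
  cubic equation of an idempotent all rest on instances of it.\<close>

lemma mul_product:
  "((y \<odot> z) \<odot> w) \<odot> x = (z \<odot> w) \<odot> (y \<odot> x) + (y \<odot> z) \<odot> (w \<odot> x) + (y \<odot> w) \<odot> (z \<odot> x)
    - z \<odot> (w \<odot> (y \<odot> x)) - y \<odot> (w \<odot> (z \<odot> x))"
proof -
  have "(x \<odot> y) \<odot> (z \<odot> w) + (y \<odot> z) \<odot> (x \<odot> w) + (z \<odot> x) \<odot> (y \<odot> w)
    = z \<odot> ((x \<odot> y) \<odot> w) + x \<odot> ((y \<odot> z) \<odot> w) + y \<odot> ((z \<odot> x) \<odot> w)"
    by (rule jordan_polarized)
  then show ?thesis
    by (simp add: mul_comm[of x] mul_comm[of _ w] mul_comm[of "z \<odot> x"] mul_comm[of "y \<odot> x"])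
qed

text \<open>The commutator \<open>[L\<^sub>x, L\<^sub>y]\<close>.\<close>

definition D :: "'a \<Rightarrow> 'a \<Rightarrow> 'a \<Rightarrow> 'a" where
  "D x y v = x \<odot> (y \<odot> v) - y \<odot> (x \<odot> v)"

lemma linear_D: "linear (D x y)"
  by (rule linearI) (simp_all add: D_def mul_simps algebra_simps)

lemma D_derivation: "D x y (u \<odot> v) = D x y u \<odot> v + u \<odot> D x y v"
proof -
  have "((y \<odot> u) \<odot> x) \<odot> v - ((x \<odot> u) \<odot> y) \<odot> v = D x y (u \<odot> v) - u \<odot> D x y v"
    unfolding mul_product[of y u x v] mul_product[of x u y v]
    by (simp add: D_def mul_simps mul_comm[of y u] mul_comm[of x u] mul_comm[of y x])
  moreover have "((y \<odot> u) \<odot> x) \<odot> v - ((x \<odot> u) \<odot> y) \<odot> v = D x y u \<odot> v"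
    by (simp add: D_def mul_simps mul_comm[of x] mul_comm[of y])
  ultimately show ?thesis by (simp add: algebra_simps)
qed

lemma linear_comp: "linear f \<Longrightarrow> linear g \<Longrightarrow> linear (\<lambda>x. f (g x))"
  using linear_compose[of g f] by (simp add: o_def)

lemma linear_mul_mul: "linear (\<lambda>v. a \<odot> (b \<odot> v))"
  by (rule linear_comp[OF linear_mul(1)[of a] linear_mul(1)[of b]])

lemma linear_mul_D: "linear (\<lambda>v. a \<odot> D b c v)" "linear (\<lambda>v. D b c (a \<odot> v))"
  by (rule linear_comp[OF linear_mul(1)[of a] linear_D[of b c]])
    (rule linear_comp[OF linear_D[of b c] linear_mul(1)[of a]])

lemma trace_add:
  fixes f g :: "'a \<Rightarrow> 'a"
  assumes "linear f" "linear g"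
  shows "lin_trace (\<lambda>x. f x + g x) = lin_trace f + lin_trace g"
  using exists_finite_inner_space[OF finite_dim] finite_inner_space.trace_add[OF _ assms] by blast

lemma trace_scaleR:
  fixes f :: "'a \<Rightarrow> 'a"
  assumes "linear f"
  shows "lin_trace (\<lambda>x. c *\<^sub>R f x) = c * lin_trace f"
  using exists_finite_inner_space[OF finite_dim] finite_inner_space.trace_scaleR[OF _ assms] by blast

lemma trace_diff:
  fixes f g :: "'a \<Rightarrow> 'a"
  assumes "linear f" "linear g"
  shows "lin_trace (\<lambda>x. f x - g x) = lin_trace f - lin_trace g"
  using trace_add[OF assms(1) linear_compose_scale_right[OF assms(2), of "-1"]]
    trace_scaleR[OF assms(2), of "-1"] by simp

lemma trace_compose_commute:
  fixes f g :: "'a \<Rightarrow> 'a"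
  assumes "linear f" "linear g"
  shows "lin_trace (\<lambda>x. f (g x)) = lin_trace (\<lambda>x. g (f x))"
  using exists_finite_inner_space[OF finite_dim]
    finite_inner_space.trace_compose_commute[OF _ assms] by blast

lemma trace_idempotent_nonneg:
  fixes P :: "'a \<Rightarrow> 'a"
  assumes "linear P" "\<And>x. P (P x) = P x"
  shows "lin_trace P \<ge> 0" and "P a \<noteq> 0 \<Longrightarrow> lin_trace P > 0"
  using exists_finite_inner_space[OF finite_dim]
    finite_inner_space.trace_idempotent_nonneg[OF _ assms] by blast+

definition \<tau> :: "'a \<Rightarrow> 'a \<Rightarrow> real" where
  "\<tau> x y = lin_trace (mul (x \<odot> y))"

definition \<beta> :: "'a \<Rightarrow> 'a \<Rightarrow> real" where
  "\<beta> x y = lin_trace (\<lambda>v. x \<odot> (y \<odot> v))"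

lemma trace_mul_linear: "linear (\<lambda>x. lin_trace (mul x))"
proof (rule linearI)
  fix x y :: 'a and c :: real
  show "lin_trace (mul (x + y)) = lin_trace (mul x) + lin_trace (mul y)"
    unfolding trace_add[OF linear_mul(1) linear_mul(1), symmetric]
    by (rule arg_cong[of _ _ lin_trace]) (simp add: mul_simps fun_eq_iff)
  show "lin_trace (mul (c *\<^sub>R x)) = c *\<^sub>R lin_trace (mul x)"
    unfolding real_scaleR_def trace_scaleR[OF linear_mul(1), symmetric]
    by (rule arg_cong[of _ _ lin_trace]) (simp add: mul_simps fun_eq_iff)
qed

lemma \<tau>_bilinear: "bilinear \<tau>"
  unfolding bilinear_def \<tau>_def
  using linear_comp[OF trace_mul_linear linear_mul(2)] linear_comp[OF trace_mul_linear linear_mul(3)]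
  by blast

lemma \<tau>_sym: "\<tau> x y = \<tau> y x"
  by (simp add: \<tau>_def mul_comm)

lemma \<beta>_sym: "\<beta> x y = \<beta> y x"
  unfolding \<beta>_def by (rule trace_compose_commute) (rule linear_mul)+

text \<open>Two instances of \<open>mul_product\<close> differ by triple products that cancel in the trace after
  cyclic permutation.\<close>

lemma \<tau>_assoc: "\<tau> (x \<odot> y) z = \<tau> x (y \<odot> z)"
proof -
  have l: "linear (\<lambda>v. a \<odot> (b \<odot> (c \<odot> v)))" for a b c
    by (rule linear_comp[OF linear_mul(1)[of a] linear_mul_mul[of b c]])
  have *: "lin_trace (\<lambda>v. a \<odot> (b \<odot> (c \<odot> v))) = lin_trace (\<lambda>v. c \<odot> (a \<odot> (b \<odot> v)))" for a b c
    by (rule trace_compose_commute[of "\<lambda>v. a \<odot> (b \<odot> v)" "mul c"])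
      (rule linear_mul_mul linear_mul)+
  have "(\<lambda>v. ((y \<odot> x) \<odot> z) \<odot> v - ((z \<odot> y) \<odot> x) \<odot> v)
      = (\<lambda>v. (y \<odot> (x \<odot> (z \<odot> v)) - x \<odot> (z \<odot> (y \<odot> v))) + (z \<odot> (x \<odot> (y \<odot> v)) - y \<odot> (z \<odot> (x \<odot> v))))"
    unfolding fun_eq_iff mul_product[of y x z] mul_product[of z y x]
    by (simp add: mul_comm[of x y] mul_comm[of z x] mul_comm[of z y])
  moreover have "lin_trace \<dots> = 0"
    by (simp add: trace_diff trace_add l linear_compose_sub *[of x z y] *[of z x y])
  ultimately have "lin_trace (mul ((y \<odot> x) \<odot> z)) - lin_trace (mul ((z \<odot> y) \<odot> x)) = 0"
    by (simp only: trace_diff[OF linear_mul(1) linear_mul(1), symmetric])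
  then show ?thesis
    by (simp add: \<tau>_def mul_comm[of x y] mul_comm[of x "y \<odot> z"] mul_comm[of z y])
qed

text \<open>Since \<open>[D, L\<^sub>u] = L\<^bsub>D u\<^esub>\<close> for a derivation \<open>D\<close>, cyclicity gives
  \<open>Tr (D [L\<^sub>x, L\<^sub>u]) = - Tr (L\<^sub>x [D, L\<^sub>u]) = - \<beta> x (D u)\<close>.\<close>

lemma trace_D_D: "lin_trace (\<lambda>v. D a b (D x u v)) = - \<beta> x (D a b u)"
proof -
  have l: "linear (\<lambda>v. f (x \<odot> v))" "linear (\<lambda>v. x \<odot> f v)" if "linear f" for f x
    using linear_comp[OF that linear_mul(1)[of x]] linear_comp[OF linear_mul(1)[of x] that] .
  have "lin_trace (\<lambda>v. D a b (D x u v))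
      = lin_trace (\<lambda>v. D a b (x \<odot> (u \<odot> v))) - lin_trace (\<lambda>v. D a b (u \<odot> (x \<odot> v)))"
    by (simp add: D_def[of x u] linear_diff[OF linear_D]
        trace_diff[OF l(1)[OF linear_mul_D(2)] l(1)[OF linear_mul_D(2)]])
  also have "lin_trace (\<lambda>v. D a b (x \<odot> (u \<odot> v))) = lin_trace (\<lambda>v. u \<odot> D a b (x \<odot> v))"
    by (rule trace_compose_commute[of "\<lambda>v. D a b (x \<odot> v)" "mul u"]) (rule linear_mul_D linear_mul)+
  also have "lin_trace (\<lambda>v. D a b (u \<odot> (x \<odot> v)))
      = lin_trace (\<lambda>v. D a b u \<odot> (x \<odot> v) + u \<odot> D a b (x \<odot> v))"
    by (simp only: D_derivation)
  also have "\<dots> = \<beta> (D a b u) x + lin_trace (\<lambda>v. u \<odot> D a b (x \<odot> v))"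
    by (simp add: trace_add linear_mul_mul l linear_mul_D \<beta>_def)
  finally show ?thesis by (simp add: \<beta>_sym)
qed

lemma \<tau>_D: "\<tau> (D a b x) y = - \<tau> x (D a b y)"
proof -
  note lin = bilinear_lsub[OF \<tau>_bilinear] bilinear_rsub[OF \<tau>_bilinear]
  have "\<tau> (a \<odot> z) w = \<tau> z (a \<odot> w)" for a z w
    using \<tau>_assoc[of z a w] by (simp add: mul_comm)
  then show ?thesis by (simp add: D_def lin)
qed

lemma \<beta>_D: "\<beta> (D a b x) y = - \<beta> x (D a b y)"
proof -
  have l: "linear (\<lambda>v. f (x \<odot> v))" "linear (\<lambda>v. x \<odot> f v)" if "linear f" for f x
    using linear_comp[OF that linear_mul(1)[of x]] linear_comp[OF linear_mul(1)[of x] that] .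
  have "lin_trace (\<lambda>v. D a b (x \<odot> (y \<odot> v))) = lin_trace (\<lambda>v. x \<odot> (y \<odot> D a b v))"
    by (rule trace_compose_commute) (rule linear_mul_mul linear_D)+
  also have "(\<lambda>v. D a b (x \<odot> (y \<odot> v)))
      = (\<lambda>v. D a b x \<odot> (y \<odot> v) + (x \<odot> (D a b y \<odot> v) + x \<odot> (y \<odot> D a b v)))"
    by (simp add: D_derivation mul_simps)
  finally show ?thesis
    by (simp add: trace_add l linear_compose_add linear_mul_mul linear_mul_D linear_D \<beta>_def)
qed

end

section \<open>Formally real algebras and the spectral decomposition\<close>

locale formally_real_jordan = jordan_algebra +
  fixes e :: 'a
  assumes unit: "e \<odot> x = x"
    and formally_real: "x \<odot> x + y \<odot> y = 0 \<Longrightarrow> x = 0 \<and> y = 0"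
begin

lemma unit_right: "x \<odot> e = x"
  using unit mul_comm by metis

lemma square_eq_0: "x \<odot> x = 0 \<Longrightarrow> x = 0"
  using formally_real[of x 0] by (simp add: mul_simps)

abbreviation pow :: "'a \<Rightarrow> nat \<Rightarrow> 'a" where
  "pow x n \<equiv> (mul x ^^ n) e"

lemma square_mul_pow: "(x \<odot> x) \<odot> pow x n = pow x (Suc (Suc n))"
  by (induction n) (simp_all add: unit_right flip: jordan_identity)

text \<open>\<open>mul_product\<close> writes \<open>L\<^bsub>x\<^sup>2w\<^esub>\<close> through \<open>L\<^sub>x\<close>, \<open>L\<^sub>w\<close>, \<open>L\<^bsub>x\<^sup>2\<^esub>\<close> and \<open>L\<^bsub>xw\<^esub>\<close>, so what commutes with
  these commutes with it. With \<open>w\<close> a power of \<open>x\<close> this is a two-step induction on the exponent.\<close>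

lemma pow_commute_step:
  assumes A: "linear A" "\<And>v. A (x \<odot> v) = x \<odot> A v" "\<And>v. A ((x \<odot> x) \<odot> v) = (x \<odot> x) \<odot> A v"
    and w: "\<And>v. A (w \<odot> v) = w \<odot> A v" "\<And>v. A ((x \<odot> w) \<odot> v) = (x \<odot> w) \<odot> A v"
  shows "A (((x \<odot> x) \<odot> w) \<odot> v) = ((x \<odot> x) \<odot> w) \<odot> A v"
  unfolding mul_product[of x x w]
  by (simp only: linear_add[OF A(1)] linear_diff[OF A(1)] A(2,3) w)

lemma pow_commute:
  "x \<odot> (pow x n \<odot> v) = pow x n \<odot> (x \<odot> v)
    \<and> (x \<odot> x) \<odot> (pow x n \<odot> v) = pow x n \<odot> ((x \<odot> x) \<odot> v)"
proof (induction n arbitrary: v rule: induct_nat_012)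
  case (ge2 n)
  have "A (((x \<odot> x) \<odot> pow x n) \<odot> v) = ((x \<odot> x) \<odot> pow x n) \<odot> A v"
    if "A = mul x \<or> A = mul (x \<odot> x)" for A v
    using that ge2 linear_mul(1)
    by (intro pow_commute_step) (auto simp: jordan_identity)
  then show ?case by (simp only: square_mul_pow) blast
qed (simp_all add: unit unit_right jordan_identity)

abbreviation ev :: "'a \<Rightarrow> real poly \<Rightarrow> 'a" where
  "ev x p \<equiv> poly_op (mul x) e p"

lemmas ev_simps = poly_op_pCons[OF linear_mul(1)] poly_op_add[OF linear_mul(1)]
  poly_op_smult[OF linear_mul(1)] poly_op_diff[OF linear_mul(1)] poly_op_sum[OF linear_mul(1)]

lemma ev_commute: "x \<odot> (ev x p \<odot> v) = ev x p \<odot> (x \<odot> v)"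
proof -
  have "ev x p \<in> {y. x \<odot> (y \<odot> v) = y \<odot> (x \<odot> v)}"
    by (rule poly_op_in_subspace[OF linear_mul(1)])
      (auto simp: subspace_def mul_simps pow_commute)
  then show ?thesis by simp
qed

text \<open>Power associativity: multiplication by a polynomial in \<open>x\<close> commutes with \<open>L\<^sub>x\<close>.\<close>

lemma ev_mult: "ev x (p * q) = ev x p \<odot> ev x q"
proof (induction p)
  case (pCons a p)
  have "(x \<odot> ev x p) \<odot> ev x q = x \<odot> (ev x p \<odot> ev x q)"
    using ev_commute[of x q "ev x p"] by (simp add: mul_comm)
  then show ?case
    by (simp add: ev_simps pCons.IH mul_simps unit)
qed (simp add: mul_simps)

lemma ev_square_eq_0: "ev x (p * p) = 0 \<Longrightarrow> ev x p = 0"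
  by (rule square_eq_0) (simp only: ev_mult)

text \<open>The annihilating polynomial can be replaced by one with simple real roots: formal reality
  removes quadratic factors (a sum of two squares vanishes) and repeated factors (a square
  vanishes). The auxiliary factor \<open>s\<close> lets the induction pass to a factor of \<open>p\<close>.\<close>

lemma ev_split:
  assumes "p \<noteq> 0"
  shows "\<exists>R. finite R \<and> (\<forall>s. ev x (p * s) = 0 \<longrightarrow> ev x ((\<Prod>a\<in>R. [:-a, 1:]) * s) = 0)"
  using assms
proof (induction "degree p" arbitrary: p rule: less_induct)
  case less
  show ?case
  proof (cases "degree p > 0")
    case False
    then obtain c where c: "p = [:c:]" by (metis degree_eq_zeroE gr0I)
    then have "c \<noteq> 0" using less.prems by auto
    then have "ev x (p * s) = 0 \<longrightarrow> ev x s = 0" for s by (simp add: c ev_simps)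
    then show ?thesis by (intro exI[of _ "{}"]) simp
  next
    case True
    then consider a q where "p = [:-a, 1:] * q"
      | a b q where "b \<noteq> 0" "p = ([:-a, 1:]^2 + [:b^2:]) * q"
      using real_poly_factor_cases by blast
    then show ?thesis
    proof cases
      case 1
      have q: "q \<noteq> 0" using less.prems 1 by auto
      have d: "degree q < degree p" unfolding 1 by (subst degree_mult_eq) (use q in auto)
      obtain R where R: "finite R"
        "\<And>s. ev x (q * s) = 0 \<Longrightarrow> ev x ((\<Prod>a\<in>R. [:-a, 1:]) * s) = 0"
        using less.hyps[OF d q] by blast
      have s: "ev x ((\<Prod>a\<in>R. [:-a, 1:]) * ([:-a, 1:] * s)) = 0" if "ev x (p * s) = 0" for s
        by (rule R(2)) (use that in \<open>simp only: 1 mult_ac\<close>)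
      show ?thesis
      proof (cases "a \<in> R")
        case False
        have "ev x ((\<Prod>a\<in>insert a R. [:-a, 1:]) * s) = 0" if "ev x (p * s) = 0" for s
          using s[OF that] unfolding prod.insert[OF R(1) False] by (simp only: mult_ac)
        then show ?thesis using R(1) by blast
      next
        case True
        let ?Q = "\<Prod>a\<in>R - {a}. [:-a, 1:]"
        have P: "(\<Prod>a\<in>R. [:-a, 1:]) = [:-a, 1:] * ?Q" by (rule prod.remove[OF R(1) True])
        have "ev x ((\<Prod>a\<in>R. [:-a, 1:]) * s) = 0" if "ev x (p * s) = 0" for s
        proof (rule ev_square_eq_0)
          have "(\<Prod>a\<in>R. [:-a, 1:]) * s * ((\<Prod>a\<in>R. [:-a, 1:]) * s)
              = ((\<Prod>a\<in>R. [:-a, 1:]) * ([:-a, 1:] * s)) * (?Q * s)"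
            unfolding P by (simp only: mult_ac)
          then show "ev x ((\<Prod>a\<in>R. [:-a, 1:]) * s * ((\<Prod>a\<in>R. [:-a, 1:]) * s)) = 0"
            using s[OF that] by (simp only: ev_mult mul_simps)
        qed
        then show ?thesis using R(1) by blast
      qed
    next
      case 2
      have q: "q \<noteq> 0" using less.prems 2 by auto
      let ?m = "[:-a, 1:]^2 + [:b^2:]"
      have dm: "degree ?m = 2" by (simp add: power2_eq_square)
      then have "?m \<noteq> 0" by (metis degree_0 zero_neq_numeral)
      then have d: "degree q < degree p" unfolding 2(2) degree_mult_eq[OF \<open>?m \<noteq> 0\<close> q] dm by simp
      have "ev x (q * s) = 0" if s: "ev x (p * s) = 0" for s
      proof -
        let ?y = "ev x ([:-a, 1:] * (q * s))" and ?z = "ev x ([:b:] * (q * s))"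
        have b2: "[:b\<^sup>2:] = [:b:] * [:b:]" by (simp add: power2_eq_square)
        have "?m * (q * s) * (q * s) = ([:-a, 1:] * (q * s)) * ([:-a, 1:] * (q * s))
            + ([:b:] * (q * s)) * ([:b:] * (q * s))"
          unfolding b2 power2_eq_square[of "[:-a, 1:]"] by (simp only: ring_distribs mult_ac)
        moreover have "ev x (?m * (q * s) * (q * s)) = 0"
          using s unfolding 2(2) ev_mult[of x "?m * (q * s)"] by (simp only: mult.assoc mul_simps)
        ultimately have "?y \<odot> ?y + ?z \<odot> ?z = 0"
          by (simp only: ev_simps ev_mult)
        then have "?z = 0" using formally_real by blast
        then show ?thesis using 2(1) by (simp add: ev_simps)
      qed
      then show ?thesis using less.hyps[OF d q] by blast
    qed
  qed
qed

text \<open>Lagrange interpolation at the simple real roots: the idempotents are the values at \<open>x\<close> of the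
  Lagrange basis polynomials.\<close>

lemma spectral_decomposition:
  "\<exists>R c. finite R \<and> (\<forall>a\<in>R. c a \<odot> c a = c a)
    \<and> x = (\<Sum>a\<in>R. a *\<^sub>R c a) \<and> x \<odot> x = (\<Sum>a\<in>R. a\<^sup>2 *\<^sub>R c a)"
proof -
  obtain p where p: "p \<noteq> 0" "ev x p = 0"
    using exists_annihilating_poly[OF linear_mul(1) finite_dim] by blast
  obtain R where R: "finite R" "\<And>s. ev x (p * s) = 0 \<Longrightarrow> ev x ((\<Prod>a\<in>R. [:-a, 1:]) * s) = 0"
    using ev_split[OF p(1)] by blast
  have ev0: "ev x f = 0" if f: "\<And>a. a \<in> R \<Longrightarrow> poly f a = 0" for f
  proof -
    have "ev x (\<Prod>a\<in>R. [:-a, 1:]) = 0" using R(2)[of 1] p(2) by simp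
    moreover obtain g where "f = (\<Prod>a\<in>R. [:-a, 1:]) * g"
      using prod_linear_dvd[OF R(1) f] by (auto simp: dvd_def)
    ultimately show ?thesis by (simp add: ev_mult mul_simps)
  qed
  have ev_eq: "ev x f = ev x g" if "\<And>a. a \<in> R \<Longrightarrow> poly f a = poly g a" for f g
    using ev0[of "f - g"] that by (simp add: ev_simps)
  define q where "q a = (\<Prod>b\<in>R - {a}. [:-b, 1:])" for a
  define l where "l a = smult (1 / poly (q a) a) (q a)" for a
  have l: "poly (l a) b = (if a = b then 1 else 0)" if "a \<in> R" "b \<in> R" for a b
    using that R(1) by (auto simp: l_def q_def poly_prod)
  have interp: "ev x f = (\<Sum>a\<in>R. poly f a *\<^sub>R ev x (l a))" for f
  proof -
    have "ev x f = ev x (\<Sum>a\<in>R. smult (poly f a) (l a))"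
    proof (rule ev_eq)
      fix b assume b: "b \<in> R"
      have "poly (\<Sum>a\<in>R. smult (poly f a) (l a)) b = (\<Sum>a\<in>R. if a = b then poly f a else 0)"
        unfolding poly_sum by (rule sum.cong) (use b l in auto)
      then show "poly f b = poly (\<Sum>a\<in>R. smult (poly f a) (l a)) b" using b R(1) by simp
    qed
    then show ?thesis by (simp add: ev_simps)
  qed
  have idem: "ev x (l a) \<odot> ev x (l a) = ev x (l a)" if "a \<in> R" for a
    unfolding ev_mult[symmetric] by (rule ev_eq) (use that l in auto)
  have x: "x = ev x [:0, 1:]" by (simp add: ev_simps unit_right mul_simps)
  have "x \<odot> x = ev x ([:0, 1:] * [:0, 1:])" unfolding ev_mult x[symmetric] ..
  then have "x \<odot> x = (\<Sum>a\<in>R. a\<^sup>2 *\<^sub>R ev x (l a))"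
    unfolding interp[of "[:0, 1:] * [:0, 1:]"] by (simp add: power2_eq_square)
  moreover have "x = (\<Sum>a\<in>R. a *\<^sub>R ev x (l a))"
    using interp[of "[:0, 1:]"] unfolding x[symmetric] by simp
  ultimately show ?thesis
    using R(1) idem by (intro exI[of _ R] exI[of _ "\<lambda>a. ev x (l a)"] conjI ballI)
qed

text \<open>For an idempotent, \<open>mul_product\<close> reduces to \<open>2 L\<^sup>3 - 3 L\<^sup>2 + L = 0\<close>. Hence \<open>L = P + Q / 2\<close>, where
  \<open>P\<close> and \<open>Q\<close> are the projections onto the eigenspaces for \<open>1\<close> and \<open>1/2\<close>; traces of projections
  are not negative, and \<open>P\<close> fixes \<open>c\<close>.\<close>

lemma trace_idempotent_pos:
  assumes c: "c \<odot> c = c"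
  shows "lin_trace (mul c) \<ge> 0" and "c \<noteq> 0 \<Longrightarrow> lin_trace (mul c) > 0"
proof -
  have cubic: "c \<odot> (c \<odot> (c \<odot> v)) + c \<odot> (c \<odot> (c \<odot> v))
      = c \<odot> (c \<odot> v) + c \<odot> (c \<odot> v) + c \<odot> (c \<odot> v) - c \<odot> v" for v
    using mul_product[of c c c v] by (simp add: c algebra_simps)
  define P where "P v = 2 *\<^sub>R (c \<odot> (c \<odot> v)) - c \<odot> v" for v
  define Q where "Q v = 4 *\<^sub>R (c \<odot> v - c \<odot> (c \<odot> v))" for v
  have l: "linear P" "linear Q"
    unfolding P_def Q_def by (rule linearI; simp add: mul_simps algebra_simps)+
  have cP: "c \<odot> P v = P v" for v
    using cubic[of v] by (simp add: P_def mul_simps scaleR_2)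
  have cQ: "c \<odot> Q v = (1/2) *\<^sub>R Q v" for v
  proof -
    let ?X = "c \<odot> (c \<odot> v) - c \<odot> (c \<odot> (c \<odot> v))"
    have "c \<odot> Q v = 2 *\<^sub>R (?X + ?X)"
      by (simp add: Q_def mul_simps flip: scaleR_2)
    also have "?X + ?X = c \<odot> v - c \<odot> (c \<odot> v)"
      using cubic[of v] by (simp add: algebra_simps)
    finally show ?thesis by (simp add: Q_def)
  qed
  have P: "P (P v) = P v" for v
    unfolding P_def[of "P v"] by (simp add: cP scaleR_2)
  have Q: "Q (Q v) = Q v" for v
    unfolding Q_def[of "Q v"] by (simp add: cQ mul_simps flip: scaleR_diff_left)
  have "mul c = (\<lambda>v. P v + (1/2) *\<^sub>R Q v)"
    by (rule ext) (simp add: P_def Q_def scaleR_diff_right scaleR_2)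
  then have tr: "lin_trace (mul c) = lin_trace P + (1/2) * lin_trace Q"
    by (simp add: trace_add trace_scaleR l linear_compose_scale_right)
  note nonneg = trace_idempotent_nonneg[OF l(1) P] trace_idempotent_nonneg(1)[OF l(2) Q]
  show "lin_trace (mul c) \<ge> 0" unfolding tr using nonneg by simp
  assume "c \<noteq> 0"
  moreover have "P c = c" by (simp add: P_def c scaleR_2)
  ultimately show "lin_trace (mul c) > 0" unfolding tr using nonneg by force
qed

theorem \<tau>_inner: "inner_product \<tau>"
proof -
  have "\<tau> x x > 0" if "x \<noteq> 0" for x
  proof -
    obtain R c where R: "finite R" "\<And>a. a \<in> R \<Longrightarrow> c a \<odot> c a = c a"
      and x: "x = (\<Sum>a\<in>R. a *\<^sub>R c a)" "x \<odot> x = (\<Sum>a\<in>R. a\<^sup>2 *\<^sub>R c a)"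
      using spectral_decomposition[of x] by blast
    have eq: "\<tau> x x = (\<Sum>a\<in>R. a\<^sup>2 * lin_trace (mul (c a)))"
      unfolding \<tau>_def x(2) by (simp add: linear_sum[OF trace_mul_linear] linear_scale[OF trace_mul_linear])
    have "\<exists>a\<in>R. a *\<^sub>R c a \<noteq> 0" using that x(1) by (metis sum.neutral)
    then obtain a where a: "a \<in> R" "a \<noteq> 0" "c a \<noteq> 0" by auto
    show ?thesis unfolding eq
      by (rule sum_pos2[OF R(1) a(1)]) (use R(2) trace_idempotent_pos a in auto)
  qed
  then show ?thesis unfolding inner_product_def using \<tau>_bilinear \<tau>_sym by blast
qed

end

context formally_real_jordan
begin

section \<open>Derivations and the trace forms\<close>

definition F :: "'a set" where "F = (SOME E. orthonormal_basis \<tau> E)"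

sublocale T: finite_inner_space \<tau> F
proof
  show "inner_product \<tau>" by (rule \<tau>_inner)
  show "orthonormal_basis \<tau> F"
    unfolding F_def using someI_ex[OF exists_orthonormal_basis[OF \<tau>_inner finite_dim]] .
qed

lemma \<tau>_mul: "\<tau> (x \<odot> y) z = \<tau> y (x \<odot> z)"
  using \<tau>_assoc[of y x z] by (simp add: mul_comm)

lemma T_eqI: "(\<And>z. \<tau> x z = \<tau> y z) \<Longrightarrow> x = y"
  using inner_product_eqI[OF \<tau>_inner] by blast

text \<open>The operator that represents \<open>\<beta>\<close> with respect to \<open>\<tau>\<close>, see \<open>\<beta>_B\<close>.\<close>

definition B :: "'a \<Rightarrow> 'a" where
  "B x = (\<Sum>f\<in>F. f \<odot> (f \<odot> x))"

lemma linear_B: "linear B"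
  unfolding B_def by (intro linear_compose_sum ballI linear_mul_mul)

lemma \<beta>_B: "\<beta> x y = \<tau> x (B y)"
proof -
  have "\<beta> x y = (\<Sum>f\<in>F. \<tau> (x \<odot> (y \<odot> f)) f)"
    unfolding \<beta>_def by (rule T.trace_eq[OF linear_mul_mul])
  also have "\<dots> = (\<Sum>f\<in>F. \<tau> x (f \<odot> (f \<odot> y)))"
    by (rule sum.cong) (simp_all add: \<tau>_assoc mul_comm)
  also have "\<dots> = \<tau> x (B y)" by (simp add: B_def linear_sum[OF T.ip_linear(1)])
  finally show ?thesis .
qed

lemma B_sym: "\<tau> (B x) y = \<tau> x (B y)"
  using \<beta>_B \<beta>_sym T.ip_sym by metis

lemma B_D: "B (D a b x) = D a b (B x)"
proof (rule T_eqI)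
  fix z
  have "\<tau> (B (D a b x)) z = \<beta> z (D a b x)" by (simp add: \<beta>_B T.ip_sym)
  also have "\<dots> = - \<beta> (D a b z) x" by (simp add: \<beta>_D)
  also have "\<dots> = \<tau> z (D a b (B x))" by (simp add: \<beta>_B \<tau>_D)
  finally show "\<tau> (B (D a b x)) z = \<tau> (D a b (B x)) z" by (simp add: T.ip_sym)
qed

lemma trace_D_square: "lin_trace (\<lambda>v. D x y (D x y v)) = - (\<Sum>f\<in>F. \<tau> (D x y f) (D x y f))"
proof -
  have "lin_trace (\<lambda>v. D x y (D x y v)) = (\<Sum>f\<in>F. \<tau> (D x y (D x y f)) f)"
    by (rule T.trace_eq[OF linear_comp[OF linear_D linear_D]])
  then show ?thesis by (simp add: \<tau>_D sum_negf)
qed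

lemma \<beta>_D_nonneg: "\<beta> x (D x y y) \<ge> 0"
proof -
  have "\<beta> x (D x y y) = (\<Sum>f\<in>F. \<tau> (D x y f) (D x y f))"
    using trace_D_D[of x y x y] trace_D_square[of x y] by simp
  then show ?thesis by (simp add: sum_nonneg T.ip_self_nonneg)
qed

text \<open>A skew operator whose square has trace zero vanishes. This is how commuting multiplications
  are detected.\<close>

lemma D_eq_0:
  assumes "\<beta> x (D x y y) = 0"
  shows "D x y v = 0"
proof -
  have "(\<Sum>f\<in>F. \<tau> (D x y f) (D x y f)) = 0"
    using trace_D_D[of x y x y] trace_D_square[of x y] assms by simp
  then have "D x y f = 0" if "f \<in> F" for f
    using that by (simp add: sum_nonneg_eq_0_iff T.finite_E T.ip_self_nonneg T.ip_self_eq_0)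
  then show ?thesis
    using linear_eq_0_on_span[OF linear_D] T.span_E by blast
qed

section \<open>Blocks and their traceless parts\<close>

definition central :: "'a \<Rightarrow> bool" where
  "central z \<longleftrightarrow> (\<forall>x v. z \<odot> (x \<odot> v) = x \<odot> (z \<odot> v))"

lemma centralD: "central z \<Longrightarrow> x \<odot> (z \<odot> v) = z \<odot> (x \<odot> v)"
  by (simp add: central_def)

lemma centralD2: "central z \<Longrightarrow> (z \<odot> x) \<odot> v = z \<odot> (x \<odot> v)"
  using centralD[of z v x] by (simp add: mul_comm)

lemma D_central_right: "central z \<Longrightarrow> D x y z = 0"
  using centralD[of z x y] centralD[of z y x] by (simp add: D_def mul_comm)

text \<open>If all derivations kill \<open>z\<close>, then in particular \<open>[L\<^sub>x, L\<^sub>z] z = 0\<close>, and \<open>D_eq_0\<close> applies to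
  \<open>[L\<^sub>x, L\<^sub>z]\<close>.\<close>

lemma central_if_killed:
  assumes "\<And>x y. D x y z = 0" shows "central z"
proof -
  have "D x z v = 0" for x v
    by (rule D_eq_0) (simp add: assms \<beta>_B linear_0[OF linear_B] T.ip_simps)
  then show ?thesis by (simp add: central_def D_def)
qed

lemma D_simps: "D (a + b) y v = D a y v + D b y v" "D (c *\<^sub>R a) y v = c *\<^sub>R D a y v"
  "D y a v = - D a y v"
  by (simp_all add: D_def mul_simps algebra_simps)

text \<open>Minimal ideals are represented by their units. The ideal of \<open>p\<close> is the set of fixed points of
  \<open>L\<^sub>p\<close>, and minimality refers to ideals of the whole algebra.\<close>

definition block :: "'a \<Rightarrow> bool" where
  "block p \<longleftrightarrow> p \<noteq> 0 \<and> p \<odot> p = p \<and> central p \<and>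
     (\<forall>K. ideal_in mul UNIV K \<and> K \<subseteq> {x. p \<odot> x = x} \<longrightarrow> K = {0} \<or> K = {x. p \<odot> x = x})"

text \<open>For \<open>x\<close> in the block of \<open>p\<close>, the number \<open>\<tau> x p\<close> is the trace of \<open>L\<^sub>x\<close>.\<close>

definition traceless :: "'a \<Rightarrow> 'a set" where
  "traceless p = {x. p \<odot> x = x \<and> \<tau> x p = 0}"

lemma traceless_iff: "x \<in> traceless p \<longleftrightarrow> p \<odot> x = x \<and> \<tau> x p = 0"
  by (simp add: traceless_def)

lemma subspace_traceless: "subspace (traceless p)"
  by (simp add: subspace_def traceless_iff mul_simps T.ip_simps)

lemma ideal_UNIV_iff: "ideal_in mul UNIV K \<longleftrightarrow> subspace K \<and> (\<forall>x. \<forall>y\<in>K. x \<odot> y \<in> K)"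
  using mul_comm by (auto simp: ideal_in_def)

context
  fixes p assumes p: "block p"
begin

lemma block_simps: "p \<noteq> 0" "p \<odot> p = p" "central p"
  using p by (auto simp: block_def)

lemma block_pos: "\<tau> p p > 0"
  using T.ip_pos block_simps by blast

lemma block_ideal: "ideal_in mul UNIV {x. p \<odot> x = x}"
  by (simp add: ideal_UNIV_iff subspace_def mul_simps flip: centralD[OF block_simps(3)])

text \<open>Schur's lemma: an eigenspace of the symmetric operator \<open>L\<^sub>z\<close> in the block is an ideal.\<close>

lemma central_in_block:
  assumes z: "central z" "p \<odot> z = z"
  shows "\<exists>a. z = a *\<^sub>R p"
proof -
  let ?J = "{x. p \<odot> x = x}"
  have J: "subspace ?J" using block_ideal by (simp add: ideal_in_def)
  have zJ: "z \<odot> x \<in> ?J" if "x \<in> ?J" for x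
    using that centralD[OF block_simps(3), of z x] by simp
  obtain u c where u: "u \<in> ?J" "u \<noteq> 0" "z \<odot> u = c *\<^sub>R u"
    using T.symmetric_has_eigenvector[OF linear_mul(1)[of z] \<tau>_mul J zJ, of p] block_simps by auto
  define K where "K = {x \<in> ?J. z \<odot> x = c *\<^sub>R x}"
  have "ideal_in mul UNIV K"
    using block_ideal unfolding ideal_UNIV_iff K_def
    by (auto simp: subspace_def mul_simps algebra_simps simp flip: centralD[OF z(1)])
  moreover have "K \<subseteq> ?J" "K \<noteq> {0}" using u by (auto simp: K_def)
  ultimately have "K = ?J" using p unfolding block_def by blast
  then have "p \<in> K" using block_simps by simp
  then have "z = c *\<^sub>R p" using z(2) by (simp add: K_def mul_comm)
  then show ?thesis ..
qed

lemma central_traceless: "central z \<Longrightarrow> z \<in> traceless p \<Longrightarrow> z = 0"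
  using central_in_block[of z] block_pos by (auto simp: traceless_iff T.ip_simps)

lemma D_traceless:
  assumes "v \<in> traceless p" shows "D x y v \<in> traceless p"
proof -
  have "p \<odot> D x y v = D x y (p \<odot> v)"
    by (simp add: D_def mul_simps centralD[OF block_simps(3)])
  moreover have "\<tau> (D x y v) p = 0"
    by (simp add: \<tau>_D D_central_right[OF block_simps(3)] T.ip_simps)
  ultimately show ?thesis using assms by (simp add: traceless_iff)
qed

lemma block_decomposition:
  assumes "p \<odot> x = x"
  shows "x - (\<tau> x p / \<tau> p p) *\<^sub>R p \<in> traceless p"
  using assms block_pos block_simps by (simp add: traceless_iff mul_simps T.ip_simps)

text \<open>The situation to be excluded: an orthogonal splitting of the traceless part such that
  multiplications from different pieces commute.\<close>

definition splitting :: "'a set \<Rightarrow> 'a set \<Rightarrow> bool" where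
  "splitting U V \<longleftrightarrow> U \<subseteq> traceless p \<and> V \<subseteq> traceless p
     \<and> (\<forall>x\<in>traceless p. \<exists>u\<in>U. \<exists>v\<in>V. x = u + v)
     \<and> (\<forall>u\<in>U. \<forall>v\<in>V. \<tau> u v = 0 \<and> (\<forall>x. u \<odot> (v \<odot> x) = v \<odot> (u \<odot> x)))"

lemma splitting_sym:
  assumes "splitting U V" shows "splitting V U"
proof -
  have "\<exists>v\<in>V. \<exists>u\<in>U. x = v + u" if "x \<in> traceless p" for x
    using assms that unfolding splitting_def by (metis add.commute)
  then show ?thesis using assms T.ip_sym unfolding splitting_def by metis
qed

text \<open>Since \<open>L\<^sub>v\<close> commutes with both multiplications,
  \<open>u (u' v) = v (u u')\<close>, which is symmetric in \<open>u\<close> and \<open>u'\<close>.\<close>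

lemma splitting_D:
  assumes s: "splitting U V" and u: "u \<in> U" "u' \<in> U" and v: "v \<in> V"
  shows "D u u' v = 0"
proof -
  have *: "a \<odot> (v \<odot> x) = v \<odot> (a \<odot> x)" if "a \<in> U" for a x
    using s that v unfolding splitting_def by blast
  have "u \<odot> (u' \<odot> v) = v \<odot> (u \<odot> u')" "u' \<odot> (u \<odot> v) = v \<odot> (u' \<odot> u)"
    using *[OF u(1), of u'] *[OF u(2), of u] by (simp_all add: mul_comm)
  then show ?thesis by (simp add: D_def mul_comm)
qed

text \<open>Derivations that involve the unit, other blocks or the other piece of the splitting kill \<open>z\<close>
  anyway. So \<open>z\<close> is killed by all derivations, hence central, hence zero.\<close>

lemma splitting_killed:
  assumes s: "splitting U V" and z: "z \<in> U" and killed: "\<And>x y. x \<in> U \<Longrightarrow> y \<in> U \<Longrightarrow> D x y z = 0"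
  shows "z = 0"
proof -
  have zp: "p \<odot> z = z" "z \<in> traceless p"
    using s z by (auto simp: splitting_def traceless_iff)
  have dec: "\<exists>u\<in>U. \<exists>v\<in>V. \<forall>y. D x y z = D u y z + D v y z" for x
  proof -
    define t where "t = p \<odot> x - (\<tau> (p \<odot> x) p / \<tau> p p) *\<^sub>R p"
    have "p \<odot> (p \<odot> x) = p \<odot> x"
      using centralD2[OF block_simps(3), of p x] block_simps by simp
    then have "t \<in> traceless p" unfolding t_def by (rule block_decomposition)
    then obtain u v where uv: "u \<in> U" "v \<in> V" "t = u + v"
      using s unfolding splitting_def by blast
    have "D x y z = D u y z + D v y z" for y
    proof -
      have "D (x - p \<odot> x) y z = 0"
      proof -
        have "(x - p \<odot> x) \<odot> w = 0" if "p \<odot> w = w" for w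
          using that centralD[OF block_simps(3), of x w] centralD2[OF block_simps(3), of x w]
          by (simp add: mul_simps)
        moreover have "p \<odot> (y \<odot> z) = y \<odot> z"
          using zp centralD[OF block_simps(3), of y z] by simp
        ultimately show ?thesis using zp by (simp add: D_def mul_simps)
      qed
      moreover have "D p y z = 0" using block_simps(3) by (simp add: D_def central_def)
      moreover have "x = (x - p \<odot> x) + (\<tau> (p \<odot> x) p / \<tau> p p) *\<^sub>R p + (u + v)"
        by (simp add: t_def flip: uv(3))
      ultimately show ?thesis by (metis D_simps(1,2) add_0 scaleR_zero_right)
    qed
    then show ?thesis using uv by blast
  qed
  have "D x y z = 0" for x y
  proof -
    obtain u v where u: "u \<in> U" "v \<in> V" "D x y z = D u y z + D v y z" using dec by blast
    obtain u' v' where u': "u' \<in> U" "v' \<in> V" "\<And>w. D y w z = D u' w z + D v' w z" using dec by blast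
    have c: "D a b z = 0" "D b a z = 0" if "a \<in> U" "b \<in> V" for a b
      using s that unfolding splitting_def D_def by auto
    have "D v' v z = 0"
      by (rule splitting_D[OF splitting_sym[OF s] u'(2) u(2) z])
    then have "D y u z = 0" "D y v z = 0"
      unfolding u'(3) using killed[OF u'(1) u(1)] c(2)[OF u(1) u'(2)] c(1)[OF u'(1) u(2)] by simp_all
    then have "D u y z = 0" "D v y z = 0"
      by (simp_all add: D_simps(3)[of u] D_simps(3)[of v])
    then show ?thesis using u(3) by simp
  qed
  then have "central z" by (rule central_if_killed)
  then show ?thesis using central_traceless zp by blast
qed

text \<open>A derivation \<open>[L\<^sub>x, L\<^sub>y]\<close> with \<open>x\<close> and \<open>y\<close> in \<open>U\<close> kills \<open>V\<close>, hence the product \<open>v w\<close>, hence the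
  \<open>U\<close>-component of this product, which is therefore zero.\<close>

lemma splitting_orthogonal:
  assumes s: "splitting U V" and u: "u \<in> U" and v: "v \<in> V" "w \<in> V"
  shows "\<tau> u (v \<odot> w) = 0"
proof -
  have "v \<in> traceless p" using s v by (auto simp: splitting_def)
  then have "p \<odot> (v \<odot> w) = v \<odot> w"
    using centralD2[OF block_simps(3), of v w] by (simp add: traceless_iff)
  from block_decomposition[OF this] obtain a z w' where d: "z \<in> U" "w' \<in> V"
    "v \<odot> w - a *\<^sub>R p = z + w'"
    using s unfolding splitting_def by blast
  then have z: "z = v \<odot> w - a *\<^sub>R p - w'" by (simp add: algebra_simps)
  have "D x y z = 0" if "x \<in> U" "y \<in> U" for x y
    unfolding z linear_diff[OF linear_D] linear_scale[OF linear_D] D_derivation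
    using splitting_D[OF s that v(1)] splitting_D[OF s that v(2)] splitting_D[OF s that d(2)]
    by (simp add: D_central_right[OF block_simps(3)] mul_simps)
  then have "z = 0" by (rule splitting_killed[OF s d(1)])
  then have "v \<odot> w = a *\<^sub>R p + w'" using z by (simp add: algebra_simps)
  moreover have "\<tau> u p = 0" "\<tau> u w' = 0"
    using s u d by (auto simp: splitting_def traceless_iff)
  ultimately show ?thesis by (simp add: T.ip_simps)
qed

text \<open>By \<open>splitting_orthogonal\<close> and associativity of \<open>\<tau>\<close>, products \<open>u v\<close> are orthogonal to everything,
  so they vanish. But \<open>v (u u) = u (v u) = 0\<close> too, and \<open>u u\<close> is a nonzero multiple of \<open>p\<close> modulo
  \<open>U\<close>, so that \<open>v = 0\<close>.\<close>

lemma splitting_trivial: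
  assumes s: "splitting U V" and u: "u \<in> U" "u \<noteq> 0" and v: "v \<in> V"
  shows "v = 0"
proof -
  have t: "u \<in> traceless p" "v \<in> traceless p" using s u v by (auto simp: splitting_def)
  have zero: "u' \<odot> v' = 0" if u': "u' \<in> U" and v': "v' \<in> V" for u' v'
  proof -
    have t: "u' \<in> traceless p" "v' \<in> traceless p" using s u' v' by (auto simp: splitting_def)
    have "p \<odot> (u' \<odot> v') = u' \<odot> v'"
      using centralD2[OF block_simps(3), of u' v'] t by (simp add: traceless_iff)
    moreover have "\<tau> (u' \<odot> v') p = 0"
      using t s u' v' unfolding splitting_def by (simp add: \<tau>_assoc traceless_iff mul_comm[of v'])
    ultimately have "u' \<odot> v' \<in> traceless p" by (simp add: traceless_iff)
    then obtain a b where ab: "a \<in> U" "b \<in> V" "u' \<odot> v' = a + b"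
      using s unfolding splitting_def by blast
    have "\<tau> (u' \<odot> v') a = 0"
      using splitting_orthogonal[OF splitting_sym[OF s] v' u' ab(1)] by (simp add: \<tau>_mul)
    moreover have "\<tau> (u' \<odot> v') b = 0"
      using splitting_orthogonal[OF s u' v' ab(2)] by (simp add: \<tau>_assoc)
    ultimately have "\<tau> (u' \<odot> v') (u' \<odot> v') = 0" by (simp only: ab(3)) (simp add: T.ip_simps)
    then show ?thesis by (simp add: T.ip_self_eq_0)
  qed
  have "p \<odot> (u \<odot> u) = u \<odot> u"
    using centralD2[OF block_simps(3), of u u] t by (simp add: traceless_iff)
  from block_decomposition[OF this] obtain z w where d: "z \<in> U" "w \<in> V"
    "u \<odot> u - (\<tau> (u \<odot> u) p / \<tau> p p) *\<^sub>R p = z + w"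
    using s unfolding splitting_def by blast
  define a where "a = \<tau> (u \<odot> u) p / \<tau> p p"
  have uu: "u \<odot> u = a *\<^sub>R p + z + w" using d(3) by (simp add: a_def algebra_simps)
  have "\<tau> w (u \<odot> u) = 0" by (rule splitting_orthogonal[OF splitting_sym[OF s] d(2) u(1) u(1)])
  moreover have "\<tau> w p = 0" "\<tau> w z = 0"
    using s d T.ip_sym[of w z] by (auto simp: splitting_def traceless_iff)
  ultimately have "w = 0" by (simp add: uu T.ip_simps T.ip_self_eq_0)
  have "v \<odot> (u \<odot> u) = u \<odot> (v \<odot> u)" using s u v unfolding splitting_def by metis
  also have "\<dots> = 0" using zero[OF u(1) v] by (simp add: mul_comm[of v] mul_simps)
  finally have "a *\<^sub>R v = 0"
    using zero[OF d(1) v] t \<open>w = 0\<close> by (simp add: uu mul_simps mul_comm[of v] traceless_iff)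
  moreover have "\<tau> (u \<odot> u) p = \<tau> u u"
    using t by (simp add: \<tau>_assoc mul_comm[of u p] traceless_iff)
  then have "a \<noteq> 0" using T.ip_pos[OF u(2)] block_pos by (simp add: a_def)
  ultimately show ?thesis by simp
qed

lemma B_traceless:
  assumes "x \<in> traceless p" shows "B x \<in> traceless p"
proof -
  have "p \<odot> B x = B (p \<odot> x)"
    by (simp add: B_def linear_sum[OF linear_mul(1)] centralD[OF block_simps(3)])
  moreover have "\<tau> (B x) p = 0"
  proof -
    have "\<tau> (B x) p = lin_trace (\<lambda>v. p \<odot> (x \<odot> v))"
      by (simp add: T.ip_sym[of _ p] \<beta>_def flip: \<beta>_B)
    also have "(\<lambda>v. p \<odot> (x \<odot> v)) = mul (p \<odot> x)"
      by (simp add: centralD2[OF block_simps(3)] fun_eq_iff)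
    finally show ?thesis using assms by (simp add: traceless_iff \<tau>_sym flip: \<tau>_def)
  qed
  ultimately show ?thesis using assms by (simp add: traceless_iff)
qed

text \<open>The pieces are an eigenspace of \<open>B\<close> and its orthogonal complement: for \<open>u\<close> in the eigenspace, \<open>[L\<^sub>v, L\<^sub>u] u\<close>
  stays in it, because \<open>B\<close> commutes with derivations, so \<open>\<beta> v ([L\<^sub>v, L\<^sub>u] u) = 0\<close> and
  \<open>D_eq_0\<close> applies.\<close>

lemma B_scalar:
  assumes "x \<in> traceless p" "x \<noteq> 0"
  shows "\<exists>\<kappa>. \<forall>u\<in>traceless p. B u = \<kappa> *\<^sub>R u"
proof -
  obtain u0 \<kappa> where u0: "u0 \<in> traceless p" "u0 \<noteq> 0" "B u0 = \<kappa> *\<^sub>R u0"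
    using T.symmetric_has_eigenvector[OF linear_B B_sym subspace_traceless B_traceless assms] by blast
  define U where "U = {u \<in> traceless p. B u = \<kappa> *\<^sub>R u}"
  define V where "V = {v \<in> traceless p. \<forall>u\<in>U. \<tau> u v = 0}"
  have sU: "subspace U"
    using subspace_traceless by (auto simp: U_def subspace_def linear_add[OF linear_B]
        linear_scale[OF linear_B] linear_0[OF linear_B] algebra_simps)
  have "D v u x = 0" if "u \<in> U" "v \<in> V" for u v x
  proof (rule D_eq_0)
    have "D v u u \<in> U"
      using that D_traceless[of u v u] by (simp add: U_def B_D linear_scale[OF linear_D])
    then show "\<beta> v (D v u u) = 0"
      using that(2) T.ip_sym[of v] by (simp add: \<beta>_B U_def V_def T.ip_simps)
  qed
  moreover have "\<exists>u\<in>U. \<exists>v\<in>V. x = u + v" if x: "x \<in> traceless p" for x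
  proof -
    obtain u where u: "u \<in> U" "\<forall>z\<in>U. \<tau> (x - u) z = 0"
      using T.orthogonal_decomposition[OF sU] by blast
    then have "x - u \<in> V"
      using x subspace_diff[OF subspace_traceless x] T.ip_sym by (auto simp: U_def V_def)
    then show ?thesis using u(1) by (intro bexI[of _ u] bexI[of _ "x - u"]) auto
  qed
  ultimately have s: "splitting U V"
    unfolding splitting_def by (auto simp: U_def V_def D_def)
  have "B u = \<kappa> *\<^sub>R u" if u: "u \<in> traceless p" for u
  proof -
    obtain a b where "a \<in> U" "b \<in> V" "u = a + b" using s u unfolding splitting_def by blast
    moreover have "u0 \<in> U" using u0 by (simp add: U_def)
    ultimately have "u \<in> U" using splitting_trivial[OF s _ u0(2)] by (metis add.right_neutral)
    then show ?thesis by (simp add: U_def)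
  qed
  then show ?thesis by blast
qed

text \<open>Summing \<open>- Tr ([L\<^sub>f, L\<^sub>u]\<^sup>2) = \<beta> f ([L\<^sub>f, L\<^sub>u] u)\<close> over an orthonormal basis gives
  \<open>\<kappa> (1 - \<kappa>) \<tau> u u\<close>. It is nonnegative, and zero only if \<open>u\<close> is central.\<close>

lemma block_scalar:
  assumes u: "u \<in> traceless p" "u \<noteq> 0"
  shows "\<exists>\<kappa>. 0 < \<kappa> \<and> \<kappa> < 1 \<and> (\<forall>u\<in>traceless p. B u = \<kappa> *\<^sub>R u)"
proof -
  obtain \<kappa> where \<kappa>: "\<And>u. u \<in> traceless p \<Longrightarrow> B u = \<kappa> *\<^sub>R u" using B_scalar[OF u] by blast
  have uu: "\<tau> u u > 0" by (rule T.ip_pos[OF u(2)])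
  have \<beta>u: "\<beta> x v = \<kappa> * \<tau> x v" if "v \<in> traceless p" for x v
    using \<kappa>[OF that] by (simp add: \<beta>_B T.ip_simps)
  have "\<beta> u u = (\<Sum>f\<in>F. \<tau> (u \<odot> f) (u \<odot> f))"
    unfolding \<beta>_def T.trace_eq[OF linear_mul_mul] by (simp add: \<tau>_mul)
  moreover have "\<exists>f\<in>F. u \<odot> f \<noteq> 0"
  proof (rule ccontr)
    assume "\<not> ?thesis"
    then have "u \<odot> e = 0"
      using linear_eq_0_on_span[OF linear_mul(1), of F u e] T.span_E by auto
    then show False using u by (simp add: unit_right)
  qed
  then obtain f where f: "f \<in> F" "u \<odot> f \<noteq> 0" ..
  then have "(\<Sum>f\<in>F. \<tau> (u \<odot> f) (u \<odot> f)) > 0"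
    by (intro sum_pos2[OF T.finite_E f(1)] T.ip_pos T.ip_self_nonneg)
  ultimately have "\<kappa> * \<tau> u u > 0" using \<beta>u[OF u(1), of u] by simp
  then have pos: "\<kappa> > 0" using uu by (rule zero_less_mult_pos2)
  have "(\<Sum>f\<in>F. \<beta> f (D f u u)) = \<kappa> * (\<Sum>f\<in>F. \<tau> f (D f u u))"
    by (simp add: \<beta>u D_traceless[OF u(1)] sum_distrib_left)
  also have "(\<Sum>f\<in>F. \<tau> f (D f u u)) = (\<Sum>f\<in>F. \<tau> ((u \<odot> u) \<odot> f) f) - (\<Sum>f\<in>F. \<tau> (u \<odot> (u \<odot> f)) f)"
    by (simp add: D_def T.ip_simps sum_subtractf T.ip_sym mul_comm)
  also have "\<dots> = \<tau> u u - \<beta> u u"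
    unfolding \<tau>_def[of u u] \<beta>_def by (simp add: T.trace_eq linear_mul linear_mul_mul)
  finally have sum: "(\<Sum>f\<in>F. \<beta> f (D f u u)) = \<kappa> * (1 - \<kappa>) * \<tau> u u"
    by (simp add: \<beta>u[OF u(1)] algebra_simps)
  have "(\<Sum>f\<in>F. \<beta> f (D f u u)) \<noteq> 0"
  proof
    assume "(\<Sum>f\<in>F. \<beta> f (D f u u)) = 0"
    then have "\<beta> f (D f u u) = 0" if "f \<in> F" for f
      using that by (simp add: sum_nonneg_eq_0_iff T.finite_E \<beta>_D_nonneg)
    then have 0: "D f u v = 0" if "f \<in> F" for f v using that D_eq_0 by blast
    have "D x u v = 0" for x v
    proof (rule linear_eq_0_on_span[of "\<lambda>x. D x u v" F])
      show "linear (\<lambda>x. D x u v)" by (rule linearI) (rule D_simps)+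
      show "x \<in> span F" by (simp add: T.span_E)
    qed (rule 0)
    then have "central u" by (simp add: central_def D_def)
    then show False using central_traceless u by blast
  qed
  moreover have "(\<Sum>f\<in>F. \<beta> f (D f u u)) \<ge> 0" by (intro sum_nonneg \<beta>_D_nonneg)
  ultimately have "\<kappa> * (1 - \<kappa>) * \<tau> u u > 0" using sum by linarith
  then have "\<kappa> < 1" using pos uu by (simp add: zero_less_mult_iff)
  then show ?thesis using pos \<kappa> by blast
qed

text \<open>\<open>\<tau> p p\<close> is the trace of the projection \<open>L\<^sub>p\<close>, that is, the dimension of the block. Removing the
  projection onto the line of \<open>p\<close> leaves a nonzero projection.\<close>

lemma block_dim:
  assumes u: "u \<in> traceless p" "u \<noteq> 0"
  shows "\<tau> p p > 1"
proof -
  define Q where "Q x = \<tau> x p *\<^sub>R (1 / \<tau> p p) *\<^sub>R p" for x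
  have lQ: "linear Q" unfolding Q_def
    by (rule linearI) (simp_all add: T.ip_simps add_divide_distrib scaleR_add_left)
  have trQ: "lin_trace Q = 1"
    unfolding Q_def using T.trace_rank_one[OF T.ip_linear(2), of p "(1 / \<tau> p p) *\<^sub>R p"] block_pos
    by (simp add: T.ip_simps)
  have pp: "p \<odot> (p \<odot> x) = p \<odot> x" for x
    using centralD2[OF block_simps(3), of p x] block_simps by simp
  have "p \<odot> (p \<odot> x - Q x) - Q (p \<odot> x - Q x) = p \<odot> x - Q x" for x
    using block_pos by (simp add: Q_def mul_simps pp block_simps(2) T.ip_simps \<tau>_mul)
  moreover have "p \<odot> u - Q u \<noteq> 0" using u by (simp add: Q_def traceless_iff)
  ultimately have "lin_trace (\<lambda>x. p \<odot> x - Q x) > 0"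
    by (intro trace_idempotent_nonneg(2)[of _ u] linear_compose_sub linear_mul lQ) simp_all
  then show ?thesis
    by (simp add: trace_diff linear_mul lQ trQ \<tau>_def block_simps(2))
qed

text \<open>Otherwise the block is the line of \<open>p\<close>. An ideal of the block is an ideal of the algebra, because
  the other blocks annihilate it; so the block is a simple ideal.\<close>

lemma block_traceless_nonzero:
  assumes "\<not> (\<exists>S. simple_ideal mul S \<and> dim S = 1)"
  shows "\<exists>u\<in>traceless p. u \<noteq> 0"
proof (rule ccontr)
  assume no: "\<not> ?thesis"
  let ?J = "{x. p \<odot> x = x}"
  have "?J \<subseteq> span {p}"
  proof
    fix x assume "x \<in> ?J"
    then have "x - (\<tau> x p / \<tau> p p) *\<^sub>R p = 0" using block_decomposition[of x] no by blast
    then show "x \<in> span {p}" by (metis eq_iff_diff_eq_0 span_base span_scale singletonI)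
  qed
  then have J: "?J = span {p}"
    using block_ideal block_simps by (intro subset_antisym span_minimal) (auto simp: ideal_in_def)
  have "dim ?J = 1"
    unfolding J using block_simps(1) dim_eq_card_independent[of "{p}"] by simp
  moreover have "simple_ideal mul ?J"
    unfolding simple_ideal_def simple_algebra_on_def
  proof (intro conjI allI impI block_ideal)
    show "\<exists>x\<in>?J. \<exists>y\<in>?J. x \<odot> y \<noteq> 0"
      by (rule bexI[of _ p], rule bexI[of _ p]) (use block_simps in auto)
    fix K assume K: "ideal_in mul ?J K"
    have "x \<odot> y \<in> K" if y: "y \<in> K" for x y
    proof -
      have "y \<in> ?J" using K y by (auto simp: ideal_in_def)
      then have "x \<odot> y = (p \<odot> x) \<odot> y"
        using centralD2[OF block_simps(3), of x y] centralD[OF block_simps(3), of x y] by simp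
      moreover have "p \<odot> x \<in> ?J"
        using centralD2[OF block_simps(3), of p x] block_simps by simp
      ultimately show ?thesis using K y by (simp add: ideal_in_def)
    qed
    then have "ideal_in mul UNIV K" "K \<subseteq> ?J" using K unfolding ideal_UNIV_iff by (auto simp: ideal_in_def)
    then show "K = {0} \<or> K = ?J" using p unfolding block_def by blast
  qed
  ultimately show False using assms by blast
qed

end

section \<open>Decomposition into blocks\<close>

text \<open>A nonzero ideal \<open>J\<close> of least dimension. Its unit is the orthogonal projection \<open>p\<close> of \<open>e\<close>; since the
  orthogonal complement of an ideal is an ideal, \<open>L\<^sub>p\<close> is the projection onto \<open>J\<close> along that
  complement and commutes with every multiplication.\<close>

lemma exists_block:
  assumes I: "ideal_in mul UNIV I" "I \<noteq> {0}"
  shows "\<exists>p\<in>I. block p"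
proof -
  interpret fd: finite_dimensional_vector_space scaleR F
    by unfold_locales (use T.finite_E T.independent_E T.span_E in \<open>auto simp: dependent_raw_def span_raw_def\<close>)
  let ?P = "\<lambda>J. ideal_in mul UNIV J \<and> J \<noteq> {0} \<and> J \<subseteq> I"
  obtain J where J: "?P J" and min: "\<And>K. ?P K \<Longrightarrow> dim J \<le> dim K"
    using ex_has_least_nat[of ?P I dim] I by blast
  have subJ: "subspace J" and absorb: "\<And>x y. y \<in> J \<Longrightarrow> x \<odot> y \<in> J"
    using J by (auto simp: ideal_UNIV_iff)
  obtain p where p: "p \<in> J" "\<And>z. z \<in> J \<Longrightarrow> \<tau> (e - p) z = 0"
    using T.orthogonal_decomposition[OF subJ] by blast
  \<comment> \<open>The ideal absorbs products, so \<open>\<tau> (p x) z = \<tau> p (z x) = \<tau> e (z x) = \<tau> x z\<close>.\<close>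
  have id: "p \<odot> x = x" if "x \<in> J" for x
  proof (rule T_eqI)
    fix z
    have "\<tau> (p \<odot> x) z = \<tau> p (z \<odot> x)" by (simp add: \<tau>_assoc mul_comm)
    also have "\<dots> = \<tau> e (z \<odot> x)" using p(2)[OF absorb[OF that]] by (simp add: T.ip_simps)
    also have "\<dots> = \<tau> x z" using \<tau>_assoc[of e x z] by (simp add: unit mul_comm)
    finally show "\<tau> (p \<odot> x) z = \<tau> x z" .
  qed
  have ann: "p \<odot> y = 0" if y: "\<And>z. z \<in> J \<Longrightarrow> \<tau> y z = 0" for y
  proof (rule T_eqI)
    show "\<tau> (p \<odot> y) z = \<tau> 0 z" for z
      using y[OF absorb[OF p(1)], of z] by (simp add: \<tau>_mul T.ip_simps mul_comm[of p z])
  qed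
  have "p \<odot> (x \<odot> v) = x \<odot> (p \<odot> v)" for x v
  proof -
    obtain a where a: "a \<in> J" "\<And>z. z \<in> J \<Longrightarrow> \<tau> (v - a) z = 0"
      using T.orthogonal_decomposition[OF subJ] by blast
    have "p \<odot> (x \<odot> (v - a)) = 0"
      by (rule ann) (simp add: \<tau>_mul a(2) absorb)
    moreover have "p \<odot> (v - a) = 0" by (rule ann) (rule a(2))
    moreover have "p \<odot> (x \<odot> a) = x \<odot> a" "p \<odot> a = a" using id absorb a(1) by auto
    ultimately show ?thesis by (simp add: mul_simps)
  qed
  then have "central p" by (simp add: central_def)
  moreover have JP: "J = {x. p \<odot> x = x}"
    using id absorb[OF p(1)] by (auto simp: mul_comm) (metis mul_comm)
  moreover have "p \<noteq> 0"
  proof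
    assume "p = 0"
    then have "J \<subseteq> {0}" using id by (auto simp: mul_simps)
    then show False using J subspace_0[OF subJ] by auto
  qed
  moreover have "K = {0} \<or> K = J" if K: "ideal_in mul UNIV K" "K \<subseteq> J" for K
  proof (rule disjCI)
    assume "K \<noteq> J"
    have "subspace K" using K by (simp add: ideal_in_def)
    have "dim K < dim J"
      using fd.subspace_dim_equal[of K J] \<open>K \<noteq> J\<close> K(2) \<open>subspace K\<close> subJ
      unfolding span_raw_def dim_raw_def subspace_raw_def by (meson not_le)
    then show "K = {0}" using min[of K] K J by force
  qed
  ultimately have "block p" unfolding block_def using id[OF p(1)] by simp
  then show ?thesis using p(1) J by blast
qed

abbreviation blocks :: "'a set" where "blocks \<equiv> {p. block p}"

lemma blocks_mul_0:
  assumes p: "block p" and q: "block q" and "p \<noteq> q"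
  shows "p \<odot> q = 0"
proof -
  let ?J = "\<lambda>p. {x. p \<odot> x = x}"
  have "ideal_in mul UNIV (?J p \<inter> ?J q)"
    using block_ideal[OF p] block_ideal[OF q] by (auto simp: ideal_UNIV_iff subspace_inter)
  then consider "?J p \<inter> ?J q = {0}" | "?J p \<inter> ?J q = ?J p" "?J p \<inter> ?J q = ?J q"
    using p q unfolding block_def by blast
  then show ?thesis
  proof cases
    case 1
    have "p \<odot> q \<in> ?J p" "q \<odot> p \<in> ?J q"
      using centralD2[OF block_simps(3)[OF p], of p q] centralD2[OF block_simps(3)[OF q], of q p]
        block_simps(2)[OF p] block_simps(2)[OF q] by auto
    then show ?thesis using 1 mul_comm[of p q] by auto
  next
    case 2
    then have "p \<in> ?J q" "q \<in> ?J p" using block_simps(2)[OF p] block_simps(2)[OF q] by blast+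
    then have "p = q" using mul_comm[of p q] by simp
    then show ?thesis using assms by simp
  qed
qed

lemma blocks_orthogonal:
  assumes "block p" "block q" "p \<noteq> q" shows "\<tau> p q = 0"
  using blocks_mul_0[OF assms] by (simp add: \<tau>_def linear_0[OF trace_mul_linear])

lemma finite_blocks: "finite blocks"
proof -
  have "independent blocks"
  proof
    assume "dependent blocks"
    then obtain U u p where U: "finite U" "U \<subseteq> blocks" "(\<Sum>v\<in>U. u v *\<^sub>R v) = 0"
      and p: "p \<in> U" "u p \<noteq> 0" unfolding real_vector.dependent_explicit by blast
    have "0 = \<tau> (\<Sum>v\<in>U. u v *\<^sub>R v) p" by (simp add: U(3) T.ip_simps)
    also have "\<dots> = (\<Sum>v\<in>U. if v = p then u p * \<tau> p p else 0)"
      unfolding bilinear_sum_left[OF \<tau>_bilinear]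
      by (rule sum.cong) (use U(2) p(1) blocks_orthogonal in auto)
    also have "\<dots> = u p * \<tau> p p" using U(1) p(1) by simp
    finally show False using p U(2) block_pos[of p] by auto
  qed
  then show ?thesis
    using real_vector.independent_span_bound[OF T.finite_E, of blocks] T.span_E
    by (auto simp: dependent_raw_def)
qed

lemma sum_blocks_mul:
  assumes "block p" shows "(\<Sum>q\<in>blocks. f q *\<^sub>R (p \<odot> q)) = f p *\<^sub>R p"
proof -
  have "(\<Sum>q\<in>blocks. f q *\<^sub>R (p \<odot> q)) = (\<Sum>q\<in>blocks. if q = p then f p *\<^sub>R p else 0)"
    by (rule sum.cong) (use assms blocks_mul_0 block_simps(2) in auto)
  then show ?thesis using finite_blocks assms by simp
qed

text \<open>The defect \<open>r\<close> is a central idempotent orthogonal to all blocks. If it were nonzero, its ideal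
  would contain another block.\<close>

lemma sum_blocks: "(\<Sum>p\<in>blocks. p) = e"
proof -
  define r where "r = e - (\<Sum>p\<in>blocks. p)"
  have pr: "p \<odot> r = 0" if "block p" for p
    using sum_blocks_mul[OF that, of "\<lambda>_. 1"]
    by (simp add: r_def mul_simps linear_sum[OF linear_mul(1)] unit_right)
  have "linear (\<lambda>z. z \<odot> v)" for v by (rule linear_mul)
  then have r_mul: "r \<odot> v = v - (\<Sum>p\<in>blocks. p \<odot> v)" for v
    by (simp add: r_def mul_simps unit linear_sum[OF linear_mul(3)])
  have "central r"
    unfolding central_def r_mul mul_simps linear_sum[OF linear_mul(1)]
    by (intro allI arg_cong2[of _ _ _ _ "(-)"] refl sum.cong)
      (use centralD[OF block_simps(3)] in \<open>metis mem_Collect_eq\<close>)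
  have "r = 0"
  proof (rule ccontr)
    assume r: "r \<noteq> 0"
    have rr: "r \<odot> r = r"
      unfolding r_mul using pr by simp
    have "ideal_in mul UNIV {x. r \<odot> x = x}"
      by (simp add: ideal_UNIV_iff subspace_def mul_simps flip: centralD[OF \<open>central r\<close>])
    moreover have "{x. r \<odot> x = x} \<noteq> {0}" using r rr by auto
    ultimately obtain p where "r \<odot> p = p" "block p" using exists_block by blast
    then show False using pr[of p] block_simps(1)[of p] by (simp add: mul_comm)
  qed
  then show ?thesis by (simp add: r_def)
qed

lemma block_expand: "(\<Sum>p\<in>blocks. p \<odot> x) = x"
  using linear_sum[OF linear_mul(3), of "\<lambda>p. p" blocks x] by (simp add: sum_blocks unit)

end

section \<open>The Ricci form as a trace form\<close>

context jordan_algebra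
begin

text \<open>Substituting \<open>u x = N u x + N x u\<close> in the last term of the curvature turns \<open>ric u v\<close> into
  \<open>Tr (R\<^sub>v R\<^sub>u) - Tr R\<^bsub>N u v\<^esub>\<close>, with \<open>R\<^sub>v x = N x v\<close>, up to a commutator of trace zero. Symmetrization in \<open>u\<close> and \<open>v\<close>
  replaces \<open>N u v\<close> by \<open>(u v) / 2\<close>.\<close>

lemma jordan_Ric_trace:
  assumes ip: "inner_product ip" and N: "is_jordan_levi_civita mul ip N"
  shows "jordan_Ric mul ip u v
    = lin_trace (\<lambda>x. N (N x v) u) - lin_trace (\<lambda>x. N x (u \<odot> v)) / 2"
proof -
  have nabla: "jordan_nabla mul ip = N"
    unfolding jordan_nabla_def
    using theI'[OF ex1_jordan_levi_civita[OF ip finite_dim mul_bilinear mul_comm]] N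
      ex1_jordan_levi_civita[OF ip finite_dim mul_bilinear mul_comm] by blast
  have bil: "bilinear N" and sum: "N x y + N y x = x \<odot> y" for x y
    using N by (auto simp: is_jordan_levi_civita_def)
  have l: "linear (N x)" "linear (\<lambda>y. N y x)" for x using bil by (auto simp: bilinear_def)
  have ric: "jordan_ric mul ip u v
      = lin_trace (\<lambda>x. N (N x u) v) - lin_trace (\<lambda>x. N x (N u v))" for u v
  proof -
    have ll: "linear (\<lambda>x. N (N x u) v)" "linear (\<lambda>x. N (N u x) v)" "linear (\<lambda>x. N u (N x v))"
      using linear_comp[OF l(2)[of v] l(2)[of u]] linear_comp[OF l(2)[of v] l(1)[of u]]
        linear_comp[OF l(1)[of u] l(2)[of v]] by simp_all
    have "jordan_curvature mul ip u x v
        = (N (N x u) v - N x (N u v)) + (N (N u x) v - N u (N x v))" for x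
      unfolding jordan_curvature_def nabla Let_def sum[of u x, symmetric]
      by (simp add: bilinear_ladd[OF bil])
    then have "jordan_ric mul ip u v
      = lin_trace (\<lambda>x. (N (N x u) v - N x (N u v)) + (N (N u x) v - N u (N x v)))"
      by (simp only: jordan_ric_def)
    also have "\<dots> = lin_trace (\<lambda>x. N (N x u) v) - lin_trace (\<lambda>x. N x (N u v))
        + (lin_trace (\<lambda>x. N (N u x) v) - lin_trace (\<lambda>x. N u (N x v)))"
      using ll l(2)[of "N u v"] by (simp add: trace_add trace_diff linear_compose_sub)
    also have "lin_trace (\<lambda>x. N (N u x) v) = lin_trace (\<lambda>x. N u (N x v))"
      by (rule trace_compose_commute[of "\<lambda>y. N y v" "N u"]) (rule l)+
    finally show ?thesis by simp
  qed
  have "lin_trace (\<lambda>x. N x (u \<odot> v)) = lin_trace (\<lambda>x. N x (N u v)) + lin_trace (\<lambda>x. N x (N v u))"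
    unfolding sum[of u v, symmetric] bilinear_radd[OF bil] by (rule trace_add) (rule l)+
  moreover have "lin_trace (\<lambda>x. N (N x u) v) = lin_trace (\<lambda>x. N (N x v) u)"
    by (rule trace_compose_commute[of "\<lambda>y. N y v" "\<lambda>y. N y u"]) (rule l)+
  ultimately show ?thesis by (simp add: jordan_Ric_def ric field_simps)
qed

end

section \<open>The Einstein metric\<close>

locale block_scalars = formally_real_jordan +
  fixes \<kappa> :: "'a \<Rightarrow> real"
  assumes \<kappa>: "block p \<Longrightarrow> 0 < \<kappa> p" "block p \<Longrightarrow> \<kappa> p < 1"
    "block p \<Longrightarrow> u \<in> traceless p \<Longrightarrow> B u = \<kappa> p *\<^sub>R u"
    and block_size: "block p \<Longrightarrow> \<tau> p p > 1"
begin

text \<open>Shrinking the unit direction of \<open>p\<close> by a factor \<open>1 - 2 a\<close> makes the block Einstein for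
  \<open>a = (1 - \<kappa> p) / 4\<close>: this choice balances the Ricci form on the line of \<open>p\<close> against its value
  on the traceless part.\<close>

definition \<alpha> :: "'a \<Rightarrow> real" where "\<alpha> p = (1 - \<kappa> p) / 4"

text \<open>The coordinate of \<open>x\<close> along \<open>p\<close>.\<close>

definition \<epsilon> :: "'a \<Rightarrow> 'a \<Rightarrow> real" where "\<epsilon> p x = \<tau> x p / \<tau> p p"

text \<open>Minus the Einstein constant of the block, which makes the constant of \<open>g\<close> equal to \<open>-1\<close> on
  every block.\<close>

definition weight :: "'a \<Rightarrow> real" where "weight p = (\<tau> p p - 1) * \<alpha> p / 2"

definition g :: "'a \<Rightarrow> 'a \<Rightarrow> real" where
  "g x y = (\<Sum>p\<in>blocks. weight p * (\<tau> (p \<odot> x) y / \<tau> p p - 2 * \<alpha> p * \<epsilon> p x * \<epsilon> p y))"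

text \<open>The Levi-Civita connection of \<open>g\<close>: changing the scale of the unit directions adds only terms in
  which one argument is replaced by its coordinates along the units.\<close>

definition N :: "'a \<Rightarrow> 'a \<Rightarrow> 'a" where
  "N x y = (1/2) *\<^sub>R (x \<odot> y)
     + (\<Sum>p\<in>blocks. \<alpha> p *\<^sub>R (\<epsilon> p x *\<^sub>R (p \<odot> y) - \<epsilon> p y *\<^sub>R (p \<odot> x)))"

text \<open>The form \<open>\<tau>\<close> on the traceless components in the block of \<open>p\<close>, see \<open>\<sigma>_eq\<close>.\<close>

definition \<sigma> :: "'a \<Rightarrow> 'a \<Rightarrow> 'a \<Rightarrow> real" where
  "\<sigma> p x y = \<tau> (p \<odot> x) y - \<tau> p p * \<epsilon> p x * \<epsilon> p y"

lemma \<epsilon>_linear: "linear (\<epsilon> p)"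
  by (rule linearI) (simp_all add: \<epsilon>_def T.ip_simps add_divide_distrib)

lemmas \<epsilon>_simps = linear_add[OF \<epsilon>_linear] linear_diff[OF \<epsilon>_linear] linear_scale[OF \<epsilon>_linear]
  linear_sum[OF \<epsilon>_linear] linear_0[OF \<epsilon>_linear]

text \<open>A sum over the blocks with one summand in each: multiplication by \<open>p\<close> extracts the summand in
  the block of \<open>p\<close>.\<close>

lemma block_mul_sum:
  assumes "block p" and f: "\<And>q. block q \<Longrightarrow> f q = q \<odot> h q"
  shows "p \<odot> (\<Sum>q\<in>blocks. f q) = f p"
proof -
  have "p \<odot> (\<Sum>q\<in>blocks. f q) = (\<Sum>q\<in>blocks. if q = p then f p else 0)"
    unfolding linear_sum[OF linear_mul(1)]
  proof (rule sum.cong[OF refl])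
    fix q assume "q \<in> blocks"
    then have "p \<odot> f q = (p \<odot> q) \<odot> h q"
      using f centralD2[OF block_simps(3)[OF assms(1)]] by simp
    then show "p \<odot> f q = (if q = p then f p else 0)"
      using blocks_mul_0[OF assms(1), of q] block_simps(2)[OF assms(1)] f[OF assms(1)] \<open>q \<in> blocks\<close>
      by (auto simp: mul_simps)
  qed
  then show ?thesis using finite_blocks assms(1) by simp
qed

lemma block_nonzero: "block p \<Longrightarrow> \<tau> p p \<noteq> 0"
  using block_pos[of p] by simp

lemma \<epsilon>_mul: "\<epsilon> p (x \<odot> y) = \<tau> (p \<odot> x) y / \<tau> p p"
  unfolding \<epsilon>_def using \<tau>_assoc[of p x y] T.ip_sym[of "x \<odot> y" p] by simp

lemma \<epsilon>_block: "block p \<Longrightarrow> \<epsilon> p (p \<odot> x) = \<epsilon> p x"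
  using \<tau>_assoc[of x p p] by (simp add: \<epsilon>_def block_simps(2) mul_comm)

lemma \<epsilon>_block_same: "block p \<Longrightarrow> \<epsilon> p p = 1"
  using block_pos[of p] by (simp add: \<epsilon>_def)

lemma \<tau>_block_sym: "\<tau> (p \<odot> x) y = \<tau> (p \<odot> y) x"
  unfolding \<tau>_mul[of p x y] by (rule T.ip_sym)

lemma \<sigma>_eq:
  assumes p: "block p"
  shows "\<sigma> p x y = \<tau> (p \<odot> x - \<epsilon> p x *\<^sub>R p) (p \<odot> y - \<epsilon> p y *\<^sub>R p)"
proof -
  have n: "\<tau> p p \<noteq> 0" using p by (rule block_nonzero)
  have pp: "p \<odot> (p \<odot> x) = p \<odot> x"
    using centralD2[OF block_simps(3)[OF p], of p x] block_simps(2)[OF p] by simp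
  have "\<tau> z p = \<tau> p p * \<epsilon> p z" for z using n by (simp add: \<epsilon>_def)
  from this[of "p \<odot> x"] this[of "p \<odot> y"]
  have "\<tau> (p \<odot> x) p = \<tau> p p * \<epsilon> p x" "\<tau> p (p \<odot> y) = \<tau> p p * \<epsilon> p y"
    by (simp_all add: \<epsilon>_block[OF p] T.ip_sym[of p "p \<odot> y"])
  moreover have "\<tau> (p \<odot> x) (p \<odot> y) = \<tau> (p \<odot> x) y"
    using \<tau>_mul[of p "p \<odot> x" y] pp by simp
  ultimately show ?thesis
    by (simp add: \<sigma>_def T.ip_simps)
qed

lemma g_eq: "g x y = (\<Sum>p\<in>blocks. weight p * (\<sigma> p x y / \<tau> p p + (1 - 2 * \<alpha> p) * \<epsilon> p x * \<epsilon> p y))"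
  unfolding g_def
proof (rule sum.cong[OF refl])
  fix p assume "p \<in> blocks"
  then have "\<tau> p p \<noteq> 0" using block_pos[of p] by simp
  then show "weight p * (\<tau> (p \<odot> x) y / \<tau> p p - 2 * \<alpha> p * \<epsilon> p x * \<epsilon> p y)
      = weight p * (\<sigma> p x y / \<tau> p p + (1 - 2 * \<alpha> p) * \<epsilon> p x * \<epsilon> p y)"
    by (simp add: \<sigma>_def field_simps)
qed

lemma weight_pos: "block p \<Longrightarrow> weight p > 0" and \<alpha>_less: "block p \<Longrightarrow> 1 - 2 * \<alpha> p > 0"
  using \<kappa>[of p] block_size[of p] by (simp_all add: weight_def \<alpha>_def)

lemma g_inner: "inner_product g"
proof -
  have "bilinear g"
    unfolding bilinear_def g_def
    by (intro conjI allI linear_compose_sum ballI)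
      (auto intro!: linearI simp: mul_simps T.ip_simps \<epsilon>_simps add_divide_distrib algebra_simps)
  moreover have "g x y = g y x" for x y
    unfolding g_def by (rule sum.cong) (simp_all add: \<tau>_block_sym[of _ x y] mult_ac)
  moreover have "g x x > 0" if "x \<noteq> 0" for x
  proof -
    have "\<exists>p\<in>blocks. p \<odot> x \<noteq> 0" using that block_expand[of x] by (metis sum.neutral)
    then obtain p where p: "block p" "p \<odot> x \<noteq> 0" by blast
    have nonneg: "\<sigma> q x x / \<tau> q q \<ge> 0" "(1 - 2 * \<alpha> q) * \<epsilon> q x * \<epsilon> q x \<ge> 0" if "block q" for q
      using \<alpha>_less[OF that] block_pos[OF that] T.ip_self_nonneg
      by (simp_all add: \<sigma>_eq[OF that] mult.assoc)
    have "\<sigma> p x x / \<tau> p p + (1 - 2 * \<alpha> p) * \<epsilon> p x * \<epsilon> p x > 0"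
    proof (cases "\<epsilon> p x = 0")
      case True
      then have "\<sigma> p x x > 0" using p T.ip_pos by (simp add: \<sigma>_eq)
      then show ?thesis using block_pos[OF p(1)] True by simp
    next
      case False
      then have "(1 - 2 * \<alpha> p) * \<epsilon> p x * \<epsilon> p x > 0"
        using \<alpha>_less[OF p(1)] by (simp add: mult.assoc zero_less_mult_iff not_square_less_zero less_le)
      then show ?thesis using nonneg(1)[OF p(1)] by linarith
    qed
    then show ?thesis
      unfolding g_eq
      by (intro sum_pos2[OF finite_blocks, of p] mult_pos_pos mult_nonneg_nonneg)
        (use p nonneg weight_pos in \<open>auto intro!: add_nonneg_nonneg less_imp_le\<close>)
  qed
  ultimately show ?thesis by (auto simp: inner_product_def)
qed

lemma N_bilinear: "bilinear N"
  unfolding bilinear_def N_def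
  by (intro conjI allI linear_compose_add linear_compose_sum ballI)
    (auto intro!: linearI simp: mul_simps \<epsilon>_simps algebra_simps)

lemma block_N:
  assumes p: "block p"
  shows "p \<odot> N x y = (1/2) *\<^sub>R (p \<odot> (x \<odot> y)) + \<alpha> p *\<^sub>R (\<epsilon> p x *\<^sub>R (p \<odot> y) - \<epsilon> p y *\<^sub>R (p \<odot> x))"
proof -
  have "p \<odot> (\<Sum>q\<in>blocks. \<alpha> q *\<^sub>R (\<epsilon> q x *\<^sub>R (q \<odot> y) - \<epsilon> q y *\<^sub>R (q \<odot> x)))
      = \<alpha> p *\<^sub>R (\<epsilon> p x *\<^sub>R (p \<odot> y) - \<epsilon> p y *\<^sub>R (p \<odot> x))"
    by (rule block_mul_sum[OF p, where h = "\<lambda>q. \<alpha> q *\<^sub>R (\<epsilon> q x *\<^sub>R y - \<epsilon> q y *\<^sub>R x)"])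
      (simp add: mul_simps)
  then show ?thesis by (simp add: N_def mul_simps)
qed

lemma \<epsilon>_N: "block p \<Longrightarrow> \<epsilon> p (N x y) = \<epsilon> p (x \<odot> y) / 2"
  using \<epsilon>_block[of p "N x y"] by (simp add: block_N \<epsilon>_simps \<epsilon>_block)

lemma N_levi_civita: "is_jordan_levi_civita mul g N"
proof -
  have "N x y + N y x = x \<odot> y" for x y
  proof -
    have "N x y + N y x = (1/2) *\<^sub>R (x \<odot> y) + (1/2) *\<^sub>R (x \<odot> y)
      + (\<Sum>p\<in>blocks. \<alpha> p *\<^sub>R (\<epsilon> p x *\<^sub>R (p \<odot> y) - \<epsilon> p y *\<^sub>R (p \<odot> x))
          + \<alpha> p *\<^sub>R (\<epsilon> p y *\<^sub>R (p \<odot> x) - \<epsilon> p x *\<^sub>R (p \<odot> y)))"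
      unfolding sum.distrib by (simp add: N_def mul_comm[of y x])
    also have "\<dots> = x \<odot> y"
      by (simp add: algebra_simps flip: scaleR_left_distrib)
    finally show ?thesis .
  qed
  moreover have "g (N x y) z = g (N x z) y" for x y z
    unfolding g_def
  proof (rule sum.cong[OF refl])
    fix p assume "p \<in> blocks"
    then have p: "block p" by simp
    have "\<tau> (p \<odot> (x \<odot> y)) z = \<tau> (p \<odot> (x \<odot> z)) y"
      using centralD[OF block_simps(3)[OF p]] by (metis \<tau>_block_sym \<tau>_mul)
    then show "weight p * (\<tau> (p \<odot> N x y) z / \<tau> p p - 2 * \<alpha> p * \<epsilon> p (N x y) * \<epsilon> p z)
        = weight p * (\<tau> (p \<odot> N x z) y / \<tau> p p - 2 * \<alpha> p * \<epsilon> p (N x z) * \<epsilon> p y)"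
      using \<tau>_block_sym[of p y z]
      by (simp add: block_N[OF p] \<epsilon>_N[OF p] T.ip_simps \<epsilon>_mul) (simp add: algebra_simps diff_divide_distrib add_divide_distrib)
  qed
  moreover have "g y z = g z y" for y z by (rule inner_productD(2)[OF g_inner])
  ultimately show ?thesis
    unfolding is_jordan_levi_civita_def using N_bilinear by metis
qed

text \<open>The multiplication part of \<open>\<lambda>x. N x v\<close>; what remains has rank one on each block.\<close>

definition M :: "'a \<Rightarrow> 'a" where
  "M v = (1/2) *\<^sub>R v - (\<Sum>p\<in>blocks. (\<alpha> p * \<epsilon> p v) *\<^sub>R p)"

lemma N_right: "N x v = M v \<odot> x + (\<Sum>p\<in>blocks. \<epsilon> p x *\<^sub>R (\<alpha> p *\<^sub>R (p \<odot> v)))"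
proof -
  have "(\<Sum>p\<in>blocks. (\<alpha> p * \<epsilon> p v) *\<^sub>R p) \<odot> x = (\<Sum>p\<in>blocks. (\<alpha> p * \<epsilon> p v) *\<^sub>R (p \<odot> x))"
    unfolding linear_sum[OF linear_mul(3)] by (simp add: mul_simps)
  then show ?thesis
    unfolding N_def M_def
    by (simp add: mul_simps mul_comm[of x v] scaleR_diff_right sum_subtractf mult.commute)
qed

lemma block_M: "block p \<Longrightarrow> p \<odot> M v = (1/2) *\<^sub>R (p \<odot> v) - (\<alpha> p * \<epsilon> p v) *\<^sub>R p"
  using block_mul_sum[of p "\<lambda>q. (\<alpha> q * \<epsilon> q v) *\<^sub>R q" "\<lambda>q. (\<alpha> q * \<epsilon> q v) *\<^sub>R q"]
  by (simp add: M_def mul_simps block_simps(2))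

lemma trace_sum:
  fixes f :: "'b \<Rightarrow> 'a \<Rightarrow> 'a"
  assumes "\<And>i. i \<in> I \<Longrightarrow> linear (f i)"
  shows "lin_trace (\<lambda>x. \<Sum>i\<in>I. f i x) = (\<Sum>i\<in>I. lin_trace (f i))"
proof -
  have "lin_trace (\<lambda>x. \<Sum>i\<in>I. f i x) = (\<Sum>d\<in>F. \<tau> (\<Sum>i\<in>I. f i d) d)"
    by (rule T.trace_eq) (intro linear_compose_sum ballI assms)
  also have "\<dots> = (\<Sum>i\<in>I. \<Sum>d\<in>F. \<tau> (f i d) d)"
    unfolding linear_sum[OF T.ip_linear(2)] by (rule sum.swap)
  also have "\<dots> = (\<Sum>i\<in>I. lin_trace (f i))"
    by (rule sum.cong) (simp_all add: T.trace_eq assms)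
  finally show ?thesis .
qed

lemma linear_rank_one: "linear \<phi> \<Longrightarrow> linear (\<lambda>x. \<phi> x *\<^sub>R b)" for \<phi> :: "'a \<Rightarrow> real" and b :: 'a
  by (rule linearI) (simp_all add: linear_add linear_scale scaleR_add_left)

lemma trace_mul: "lin_trace (mul x) = (\<Sum>p\<in>blocks. \<tau> p p * \<epsilon> p x)"
proof -
  have "lin_trace (mul x) = \<tau> x e" by (simp add: \<tau>_def unit_right)
  also have "\<dots> = (\<Sum>p\<in>blocks. \<tau> x p)"
    by (simp only: sum_blocks[symmetric] linear_sum[OF T.ip_linear(1)])
  also have "\<dots> = (\<Sum>p\<in>blocks. \<tau> p p * \<epsilon> p x)"
    by (rule sum.cong) (simp_all add: \<epsilon>_def block_nonzero)
  finally show ?thesis .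
qed

lemma \<epsilon>_M: "block p \<Longrightarrow> \<epsilon> p (M v) = (1/2 - \<alpha> p) * \<epsilon> p v"
  using \<epsilon>_block[of p "M v"] by (simp add: block_M \<epsilon>_simps \<epsilon>_block \<epsilon>_block_same algebra_simps)

lemma trace_N_right:
  "lin_trace (\<lambda>x. N x v) = (\<Sum>p\<in>blocks. (\<tau> p p / 2 - \<alpha> p * \<tau> p p + \<alpha> p) * \<epsilon> p v)"
proof -
  have "lin_trace (\<lambda>x. N x v)
      = lin_trace (mul (M v)) + (\<Sum>p\<in>blocks. \<epsilon> p (\<alpha> p *\<^sub>R (p \<odot> v)))"
    unfolding N_right
    by (simp add: trace_add linear_mul linear_compose_sum linear_rank_one \<epsilon>_linear trace_sum
        T.trace_rank_one del: scaleR_scaleR)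
  also have "\<dots> = (\<Sum>p\<in>blocks. (\<tau> p p / 2 - \<alpha> p * \<tau> p p + \<alpha> p) * \<epsilon> p v)"
    unfolding trace_mul sum.distrib[symmetric]
    by (rule sum.cong) (auto simp: \<epsilon>_M \<epsilon>_simps \<epsilon>_block algebra_simps)
  finally show ?thesis .
qed

lemma B_block:
  assumes p: "block p" shows "B p = p"
proof (rule T_eqI)
  fix z
  have "(\<lambda>v. z \<odot> (p \<odot> v)) = mul (p \<odot> z)"
    using centralD[OF block_simps(3)[OF p]] centralD2[OF block_simps(3)[OF p]] by (simp add: fun_eq_iff)
  then have "\<beta> z p = \<tau> p z" by (simp add: \<beta>_def \<tau>_def)
  then show "\<tau> (B p) z = \<tau> p z" by (simp add: \<beta>_B T.ip_sym)
qed

lemma B_block_mul: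
  assumes p: "block p"
  shows "B (p \<odot> x) = \<kappa> p *\<^sub>R (p \<odot> x - \<epsilon> p x *\<^sub>R p) + \<epsilon> p x *\<^sub>R p"
proof -
  have pp: "p \<odot> (p \<odot> x) = p \<odot> x"
    using centralD2[OF block_simps(3)[OF p], of p x] block_simps(2)[OF p] by simp
  have "p \<odot> x - \<epsilon> p (p \<odot> x) *\<^sub>R p \<in> traceless p"
    using block_decomposition[OF p pp] by (simp add: \<epsilon>_def)
  then have "B (p \<odot> x - \<epsilon> p x *\<^sub>R p) = \<kappa> p *\<^sub>R (p \<odot> x - \<epsilon> p x *\<^sub>R p)"
    using \<kappa>(3)[OF p] by (simp add: \<epsilon>_block[OF p])
  then show ?thesis
    by (simp add: linear_diff[OF linear_B] linear_scale[OF linear_B] B_block[OF p] algebra_simps)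
qed

lemma \<beta>_M:
  "\<beta> (M u) (M v) = (\<Sum>p\<in>blocks. \<kappa> p * \<sigma> p u v / 4 + (1/2 - \<alpha> p)\<^sup>2 * \<tau> p p * \<epsilon> p u * \<epsilon> p v)"
proof -
  have "\<beta> (M u) (M v) = (\<Sum>p\<in>blocks. \<tau> (M u) (B (p \<odot> M v)))"
    by (subst (1) block_expand[of "M v", symmetric])
      (simp only: \<beta>_B linear_sum[OF linear_B] linear_sum[OF T.ip_linear(1)])
  also have "\<dots> = (\<Sum>p\<in>blocks. \<kappa> p * \<sigma> p u v / 4 + (1/2 - \<alpha> p)\<^sup>2 * \<tau> p p * \<epsilon> p u * \<epsilon> p v)"
  proof (rule sum.cong[OF refl])
    fix p assume "p \<in> blocks"
    then have p: "block p" by simp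
    have n: "\<tau> p p \<noteq> 0" using p by (rule block_nonzero)
    have \<tau>p: "\<tau> z p = \<tau> p p * \<epsilon> p z" for z using n by (simp add: \<epsilon>_def)
    have 1: "\<tau> (M u) (p \<odot> v) = \<tau> (p \<odot> u) v / 2 - \<alpha> p * \<epsilon> p u * \<tau> p p * \<epsilon> p v"
      using \<tau>_mul[of p "M u" v] T.ip_sym[of p v] \<tau>p[of v]
      by (simp add: block_M[OF p] T.ip_simps)
    have 2: "\<tau> (M u) p = \<tau> p p * (1/2 - \<alpha> p) * \<epsilon> p u" using \<tau>p[of "M u"] by (simp add: \<epsilon>_M[OF p])
    have "\<tau> (M u) (B (p \<odot> M v))
       = \<kappa> p * (\<tau> (M u) (p \<odot> M v) - \<epsilon> p (M v) * \<tau> (M u) p) + \<epsilon> p (M v) * \<tau> (M u) p"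
      by (simp add: B_block_mul[OF p] T.ip_simps)
    also have "\<dots> = \<kappa> p * \<sigma> p u v / 4 + (1/2 - \<alpha> p)\<^sup>2 * \<tau> p p * \<epsilon> p u * \<epsilon> p v"
      by (simp add: block_M[OF p] T.ip_simps 1 2 \<epsilon>_M[OF p] \<sigma>_def power2_eq_square)
        (simp add: field_simps)
    finally show "\<tau> (M u) (B (p \<odot> M v))
       = \<kappa> p * \<sigma> p u v / 4 + (1/2 - \<alpha> p)\<^sup>2 * \<tau> p p * \<epsilon> p u * \<epsilon> p v" .
  qed
  finally show ?thesis .
qed

lemma \<epsilon>_M_mul:
  assumes p: "block p"
  shows "\<epsilon> p (M u \<odot> (p \<odot> v)) = (\<sigma> p u v / \<tau> p p + \<epsilon> p u * \<epsilon> p v) / 2 - \<alpha> p * \<epsilon> p u * \<epsilon> p v"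
proof -
  have n: "\<tau> p p \<noteq> 0" using p by (rule block_nonzero)
  have "\<epsilon> p (M u \<odot> (p \<odot> v)) = \<tau> (p \<odot> M u) v / \<tau> p p"
    using centralD[OF block_simps(3)[OF p], of "M u" v] \<epsilon>_block[OF p, of "M u \<odot> v"]
    by (simp add: \<epsilon>_mul)
  also have "\<dots> = (\<tau> (p \<odot> u) v / 2 - \<alpha> p * \<epsilon> p u * \<tau> p v) / \<tau> p p"
    by (simp add: block_M[OF p] T.ip_simps)
  also have "\<tau> p v = \<tau> p p * \<epsilon> p v" using n T.ip_sym[of p v] by (simp add: \<epsilon>_def)
  finally show ?thesis using n by (simp add: \<sigma>_def field_simps)
qed

lemma trace_N_N:
  "lin_trace (\<lambda>x. N (N x v) u) = (\<Sum>p\<in>blocks. \<kappa> p * \<sigma> p u v / 4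
      + (1/2 - \<alpha> p)\<^sup>2 * \<tau> p p * \<epsilon> p u * \<epsilon> p v
      + \<alpha> p * (\<sigma> p u v / \<tau> p p + \<epsilon> p u * \<epsilon> p v) - 2 * (\<alpha> p)\<^sup>2 * \<epsilon> p u * \<epsilon> p v
      + (\<alpha> p)\<^sup>2 * \<epsilon> p u * \<epsilon> p v)"
proof -
  have lN: "linear (\<lambda>x. N x v)" using N_bilinear by (simp add: bilinear_def)
  have lR: "linear (\<lambda>x. \<epsilon> p x *\<^sub>R b)" for p and b :: 'a by (rule linear_rank_one[OF \<epsilon>_linear])
  have l\<epsilon>: "linear (\<lambda>x. \<epsilon> p (N x v))" for p
    using linear_compose[OF lN \<epsilon>_linear] by (simp add: o_def)
  have "M u \<odot> N x v = M u \<odot> (M v \<odot> x)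
      + (\<Sum>p\<in>blocks. \<epsilon> p x *\<^sub>R (\<alpha> p *\<^sub>R (M u \<odot> (p \<odot> v))))" for x
    by (simp add: N_right[of x v] mul_simps linear_sum[OF linear_mul(1)] del: scaleR_scaleR)
  then have "N (N x v) u = M u \<odot> (M v \<odot> x)
      + (\<Sum>p\<in>blocks. \<epsilon> p x *\<^sub>R (\<alpha> p *\<^sub>R (M u \<odot> (p \<odot> v))))
      + (\<Sum>p\<in>blocks. \<epsilon> p (N x v) *\<^sub>R (\<alpha> p *\<^sub>R (p \<odot> u)))" for x
    by (simp only: N_right[of "N x v" u])
  then have "lin_trace (\<lambda>x. N (N x v) u) = \<beta> (M u) (M v)
      + (\<Sum>p\<in>blocks. \<epsilon> p (\<alpha> p *\<^sub>R (M u \<odot> (p \<odot> v))))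
      + (\<Sum>p\<in>blocks. \<epsilon> p (N (\<alpha> p *\<^sub>R (p \<odot> u)) v))"
    by (simp add: trace_add linear_mul_mul linear_compose_sum linear_compose_add lR
        linear_rank_one[OF l\<epsilon>] trace_sum T.trace_rank_one[OF \<epsilon>_linear] T.trace_rank_one[OF l\<epsilon>] \<beta>_def
        del: scaleR_scaleR)
  also have "(\<Sum>p\<in>blocks. \<epsilon> p (N (\<alpha> p *\<^sub>R (p \<odot> u)) v))
      = (\<Sum>p\<in>blocks. \<alpha> p * (\<sigma> p u v / \<tau> p p + \<epsilon> p u * \<epsilon> p v) / 2)"
  proof (rule sum.cong[OF refl])
    fix p assume "p \<in> blocks"
    then have p: "block p" by simp
    have n: "\<tau> p p \<noteq> 0" using p by (rule block_nonzero)
    have pp: "p \<odot> (p \<odot> u) = p \<odot> u"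
      using centralD2[OF block_simps(3)[OF p], of p u] block_simps(2)[OF p] by simp
    show "\<epsilon> p (N (\<alpha> p *\<^sub>R (p \<odot> u)) v) = \<alpha> p * (\<sigma> p u v / \<tau> p p + \<epsilon> p u * \<epsilon> p v) / 2"
      using n by (simp add: \<epsilon>_N[OF p] mul_simps \<epsilon>_simps \<epsilon>_mul pp \<sigma>_def field_simps)
  qed
  finally show ?thesis
    unfolding \<beta>_M sum.distrib[symmetric]
    by (simp only:) (rule sum.cong[OF refl], simp add: \<epsilon>_simps \<epsilon>_M_mul power2_eq_square field_simps)
qed

theorem g_einstein: "jordan_Ric mul g u v = - g u v"
proof -
  have "jordan_Ric mul g u v = lin_trace (\<lambda>x. N (N x v) u) - lin_trace (\<lambda>x. N x (u \<odot> v)) / 2"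
    by (rule jordan_Ric_trace[OF g_inner N_levi_civita])
  also have "\<dots> = - g u v"
    unfolding trace_N_N trace_N_right g_eq sum_negf[symmetric] sum_divide_distrib
      sum_subtractf[symmetric]
  proof (rule sum.cong[OF refl])
    fix p assume "p \<in> blocks"
    then have p: "block p" by simp
    define n where "n = \<tau> p p"
    define s where "s = \<sigma> p u v"
    define a where "a = \<alpha> p"
    define x where "x = \<epsilon> p u"
    define y where "y = \<epsilon> p v"
    note defs = n_def s_def a_def x_def y_def
    have n: "n \<noteq> 0" using block_pos[OF p] by (simp add: defs)
    have k: "\<kappa> p = 1 - 4 * a" by (simp add: a_def \<alpha>_def field_simps)
    have m: "\<epsilon> p (u \<odot> v) = s / n + x * y"
      using block_pos[OF p] by (simp add: defs \<epsilon>_mul \<sigma>_def field_simps)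
    have "(1 - 4 * a) * s / 4 + (1/2 - a)\<^sup>2 * n * x * y + a * (s / n + x * y)
        - 2 * a\<^sup>2 * x * y + a\<^sup>2 * x * y - (n / 2 - a * n + a) * (s / n + x * y) / 2
      = - ((n - 1) * a / 2 * (s / n + (1 - 2 * a) * x * y))"
      using n by (simp add: field_simps power2_eq_square)
    then show "\<kappa> p * \<sigma> p u v / 4
      + (1/2 - \<alpha> p)\<^sup>2 * \<tau> p p * \<epsilon> p u * \<epsilon> p v
      + \<alpha> p * (\<sigma> p u v / \<tau> p p + \<epsilon> p u * \<epsilon> p v) - 2 * (\<alpha> p)\<^sup>2 * \<epsilon> p u * \<epsilon> p v
      + (\<alpha> p)\<^sup>2 * \<epsilon> p u * \<epsilon> p v
      - (\<tau> p p / 2 - \<alpha> p * \<tau> p p + \<alpha> p) * \<epsilon> p (u \<odot> v) / 2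
      = - (weight p * (\<sigma> p u v / \<tau> p p + (1 - 2 * \<alpha> p) * \<epsilon> p u * \<epsilon> p v))"
      unfolding weight_def m k by (simp only: defs)
  qed
  finally show ?thesis .
qed

end

theorem corollary5p7:
  fixes mul :: "'a::real_vector \<Rightarrow> 'a \<Rightarrow> 'a"
  assumes "\<exists>B::'a set. finite B \<and> span B = UNIV"
    and "\<exists>x::'a. x \<noteq> 0"
    and "jordan_product mul"
    and "formally_real mul"
    and "\<not> (\<exists>S. simple_ideal mul S \<and> dim S = 1)"
  shows "\<exists>ip. jordan_einstein_metric mul ip \<and> jordan_scalar_curvature mul ip < 0"
proof -
  obtain e where e: "\<And>x. mul e x = x"
    using assms(4) unfolding formally_real_def by blast
  interpret formally_real_jordan mul e
  proof
    show "\<exists>B::'a set. finite B \<and> span B = UNIV" "jordan_product mul" by fact+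
    show "mul e x = x" for x by (rule e)
    show "x = 0 \<and> y = 0" if "mul x x + mul y y = 0" for x y
      using assms(4) that unfolding formally_real_def by blast
  qed
  have "\<exists>\<kappa>. 0 < \<kappa> \<and> \<kappa> < 1 \<and> (\<forall>u\<in>traceless p. B u = \<kappa> *\<^sub>R u)" if "block p" for p
    using block_scalar[OF that] block_traceless_nonzero[OF that assms(5)] by blast
  then obtain \<kappa> where \<kappa>: "\<And>p. block p \<Longrightarrow> 0 < \<kappa> p \<and> \<kappa> p < 1 \<and> (\<forall>u\<in>traceless p. B u = \<kappa> p *\<^sub>R u)"
    by metis
  interpret block_scalars mul e \<kappa>
  proof
    fix p assume p: "block p"
    then show "0 < \<kappa> p" "\<kappa> p < 1" using \<kappa> by auto
    show "B u = \<kappa> p *\<^sub>R u" if "u \<in> traceless p" for u using \<kappa>[OF p] that by blast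
    show "\<tau> p p > 1" using block_dim[OF p] block_traceless_nonzero[OF p assms(5)] by blast
  qed
  \<comment> \<open>The basis over which the scalar curvature is summed by definition.\<close>
  define E where "E = (SOME E. orthonormal_basis g E)"
  have E: "orthonormal_basis g E"
    unfolding E_def using someI_ex[OF exists_orthonormal_basis[OF g_inner finite_dim]] .
  then have "finite E" "E \<noteq> {}" using assms(2) by (auto simp: orthonormal_basis_def)
  moreover have "jordan_scalar_curvature mul g = (\<Sum>x\<in>E. - 1)"
    unfolding jordan_scalar_curvature_def form_trace_def E_def[symmetric] g_einstein
    by (rule sum.cong) (use E in \<open>auto simp: orthonormal_basis_def\<close>)
  ultimately have "jordan_scalar_curvature mul g < 0" by (simp add: card_gt_0_iff)
  moreover have "jordan_einstein_metric mul g"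
    unfolding jordan_einstein_metric_def using g_inner g_einstein by (metis mult_minus1)
  ultimately show ?thesis by blast
qed

end
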